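(* Let $m\geq 1$ be an integer and let $\Gamma$ be a word hyperbolic group which admits a $1$-Anosov representation $\rho:\Gamma\rightarrow \mathsf{Sp}_{2m}(\mathbb{C})$. Then the Gromov boundary $\partial_\infty\Gamma$ of $\Gamma$ cannot properly contain a $2$-sphere, i.e. no proper subset of $\partial_\infty\Gamma$ is homeomorphic to $S^2$.
   Context: $\mathsf{Sp}_{2m}(\mathbb{C})\subset \mathsf{SL}_{2m}(\mathbb{C})$ is the group of linear automorphisms preserving the symplectic ($\mathbb{C}$-bilinear) form $\omega(u,v)=u^T\Omega_m v$ on $\mathbb{C}^{2m}$, where $\Omega_m=\begin{pmatrix}0&I_m\\-I_m&0\end{pmatrix}$. Anosov representations: a word hyperbolic group $\Gamma$ is equipped with a left-invariant word metric (with respect to a finite generating set), and $|\gamma|_\Gamma$ is the distance of $\gamma\in\Gamma$ from the identity. For a matrix $g\in\mathsf{SL}_d(\mathbb{C})$, $\sigma_1(g)\geq\cdots\geq\sigma_d(g)$ are its singular values. For an integer $1\leq k\leq d/2$, a representation $\rho:\Gamma\to\mathsf{SL}_d(\mathbb{C})$ is $k$-Anosov if there exist $c,\mu>0$ such that $\frac{\sigma_k(\rho(\gamma))}{\sigma_{k+1}(\rho(\gamma))}\geq c e^{\mu|\gamma|_\Gamma}$ for all $\gamma\in\Gamma$. A representation into $\mathsf{Sp}_{2m}(\mathbb{C})$ is called $k$-Anosov if it is $k$-Anosov as a representation into $\mathsf{SL}_{2m}(\mathbb{C})$. *)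

theory Defs
  imports
    "HOL-Algebra.Generated_Groups"
    "HOL-Analysis.Abstract_Euclidean_Space"
    "Jordan_Normal_Form.Schur_Decomposition"
begin

definition finite_generating_set :: "('a, 'b) monoid_scheme \<Rightarrow> 'a set \<Rightarrow> bool" where
  "finite_generating_set G S \<longleftrightarrow> finite S \<and> S \<subseteq> carrier G \<and> generate G S = carrier G"

definition word_length :: "('a, 'b) monoid_scheme \<Rightarrow> 'a set \<Rightarrow> 'a \<Rightarrow> nat" where
  "word_length G S g = (LEAST n. \<exists>ws. length ws = n \<and> set ws \<subseteq> S \<union> m_inv G ` S \<and>
     foldr (\<otimes>\<^bsub>G\<^esub>) ws \<one>\<^bsub>G\<^esub> = g)"

definition word_dist :: "('a, 'b) monoid_scheme \<Rightarrow> 'a set \<Rightarrow> 'a \<Rightarrow> 'a \<Rightarrow> real" where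
  "word_dist G S g h = real (word_length G S (inv\<^bsub>G\<^esub> g \<otimes>\<^bsub>G\<^esub> h))"

definition gromov_product :: "('a \<Rightarrow> 'a \<Rightarrow> real) \<Rightarrow> 'a \<Rightarrow> 'a \<Rightarrow> 'a \<Rightarrow> real" where
  "gromov_product d w x y = (d x w + d y w - d x y) / 2"

definition gromov_hyperbolic :: "'a set \<Rightarrow> ('a \<Rightarrow> 'a \<Rightarrow> real) \<Rightarrow> bool" where
  "gromov_hyperbolic X d \<longleftrightarrow> (\<exists>\<delta>\<ge>0. \<forall>w\<in>X. \<forall>x\<in>X. \<forall>y\<in>X. \<forall>z\<in>X.
     gromov_product d w x z \<ge> min (gromov_product d w x y) (gromov_product d w y z) - \<delta>)"

text \<open>The second argument is the finite generating set whose word metric the group is equipped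
  with.\<close>

definition word_hyperbolic :: "('a, 'b) monoid_scheme \<Rightarrow> 'a set \<Rightarrow> bool" where
  "word_hyperbolic G S \<longleftrightarrow> group G \<and> finite_generating_set G S \<and>
     gromov_hyperbolic (carrier G) (word_dist G S)"

text \<open>The boundary is the space of geodesic rays issuing from the identity, up to bounded distance,
  with the quotient of the topology of locally uniform convergence. A geodesic ray of the
  Cayley graph starting at a vertex is at a vertex exactly at integer times, so it is recorded
  by its vertex sequence; locally uniform convergence is then pointwise convergence
  in the discrete group.\<close>

definition geodesic_rays :: "('a, 'b) monoid_scheme \<Rightarrow> 'a set \<Rightarrow> (nat \<Rightarrow> 'a) set" where
  "geodesic_rays G S = {r. r 0 = \<one>\<^bsub>G\<^esub> \<and> (\<forall>i. r i \<in> carrier G) \<and>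
     (\<forall>i j. word_dist G S (r i) (r j) = \<bar>real i - real j\<bar>)}"

definition asymptotic_rel ::
    "('a, 'b) monoid_scheme \<Rightarrow> 'a set \<Rightarrow> ((nat \<Rightarrow> 'a) \<times> (nat \<Rightarrow> 'a)) set" where
  "asymptotic_rel G S = {(r, s). r \<in> geodesic_rays G S \<and> s \<in> geodesic_rays G S \<and>
     (\<exists>C. \<forall>n. word_dist G S (r n) (s n) \<le> C)}"

definition ray_topology :: "('a, 'b) monoid_scheme \<Rightarrow> 'a set \<Rightarrow> (nat \<Rightarrow> 'a) topology" where
  "ray_topology G S =
     subtopology (product_topology (\<lambda>_. discrete_topology (carrier G)) UNIV) (geodesic_rays G S)"

definition gromov_boundary :: "('a, 'b) monoid_scheme \<Rightarrow> 'a set \<Rightarrow> (nat \<Rightarrow> 'a) set topology" where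
  "gromov_boundary G S = topology (\<lambda>U. U \<subseteq> geodesic_rays G S // asymptotic_rel G S \<and>
     openin (ray_topology G S) {r \<in> geodesic_rays G S. asymptotic_rel G S `` {r} \<in> U})"

lemma openin_gromov_boundary:
  "openin (gromov_boundary G S) U \<longleftrightarrow> U \<subseteq> geodesic_rays G S // asymptotic_rel G S \<and>
     openin (ray_topology G S) {r \<in> geodesic_rays G S. asymptotic_rel G S `` {r} \<in> U}"
proof -
  let ?P = "\<lambda>U. {r \<in> geodesic_rays G S. asymptotic_rel G S `` {r} \<in> U}"
  have int: "?P (U \<inter> V) = ?P U \<inter> ?P V" for U V
    by auto
  have un: "?P (\<Union>\<K>) = \<Union> (?P ` \<K>)" for \<K>
    by auto
  have "istopology (\<lambda>U. U \<subseteq> geodesic_rays G S // asymptotic_rel G S \<and>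
      openin (ray_topology G S) (?P U))"
    unfolding istopology_def int un by (auto intro!: openin_Int openin_Union)
  then show ?thesis
    by (simp add: gromov_boundary_def)
qed

lemma topspace_ray_topology [simp]: "topspace (ray_topology G S) = geodesic_rays G S"
  by (auto simp: ray_topology_def geodesic_rays_def)

lemma topspace_gromov_boundary [simp]:
  "topspace (gromov_boundary G S) = geodesic_rays G S // asymptotic_rel G S"
proof -
  have "{r \<in> geodesic_rays G S. asymptotic_rel G S `` {r} \<in> geodesic_rays G S // asymptotic_rel G S}
      = topspace (ray_topology G S)"
    by (auto simp: quotientI)
  then have "openin (gromov_boundary G S) (geodesic_rays G S // asymptotic_rel G S)"
    unfolding openin_gromov_boundary by (metis openin_topspace order_refl)
  then show ?thesis
    by (metis openin_gromov_boundary openin_subset openin_topspace subset_antisym)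
qed

lemma quotient_map_gromov_boundary:
  "quotient_map (ray_topology G S) (gromov_boundary G S) (\<lambda>r. asymptotic_rel G S `` {r})"
  by (auto simp: quotient_map_def openin_gromov_boundary quotient_def)

definition SL_group :: "nat \<Rightarrow> complex mat monoid" where
  "SL_group d = \<lparr>carrier = {A \<in> carrier_mat d d. det A = 1}, monoid.mult = (*), one = 1\<^sub>m d\<rparr>"

definition Omega_mat :: "nat \<Rightarrow> complex mat" where
  "Omega_mat m = four_block_mat (0\<^sub>m m m) (1\<^sub>m m) (- 1\<^sub>m m) (0\<^sub>m m m)"

definition symplectic_form :: "nat \<Rightarrow> complex vec \<Rightarrow> complex vec \<Rightarrow> complex" where
  "symplectic_form m u v = u \<bullet> (Omega_mat m *\<^sub>v v)"

definition Sp_group :: "nat \<Rightarrow> complex mat monoid" where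
  "Sp_group m = (SL_group (2 * m))\<lparr>carrier := {A \<in> carrier (SL_group (2 * m)).
     \<forall>u \<in> carrier_vec (2 * m). \<forall>v \<in> carrier_vec (2 * m).
       symplectic_form m (A *\<^sub>v u) (A *\<^sub>v v) = symplectic_form m u v}\<rparr>"

text \<open>The eigenvalues of the positive semidefinite matrix \<open>A\<^sup>* A\<close> are taken with algebraic multiplicity;
  they are real, so the real part only changes the type.\<close>

definition singular_values :: "complex mat \<Rightarrow> real list" where
  "singular_values A = rev (sorted_list_of_multiset
     (image_mset (\<lambda>z. sqrt (Re z)) (proots (char_poly (mat_adjoint A * A)))))"

text \<open>Indexing starts at 1.\<close>

definition singular_value :: "nat \<Rightarrow> complex mat \<Rightarrow> real" where
  "singular_value k A = singular_values A ! (k - 1)"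

definition anosov ::
    "('a, 'b) monoid_scheme \<Rightarrow> 'a set \<Rightarrow> nat \<Rightarrow> nat \<Rightarrow> ('a \<Rightarrow> complex mat) \<Rightarrow> bool" where
  "anosov G S d k \<rho> \<longleftrightarrow> 1 \<le> k \<and> 2 * k \<le> d \<and> \<rho> \<in> hom G (SL_group d) \<and>
     (\<exists>c>0. \<exists>\<mu>>0. \<forall>\<gamma>\<in>carrier G.
        singular_value k (\<rho> \<gamma>) / singular_value (k + 1) (\<rho> \<gamma>)
          \<ge> c * exp (\<mu> * real (word_length G S \<gamma>)))"

end

theory Submission
  imports
    Defs
    "HOL-Analysis.Further_Topology"
    "HOL-Analysis.Abstract_Metric_Spaces"
begin

text \<open>
  The gap between the first two singular values makes the image lines of \<open>\<rho> (r n)\<close> converge exponentially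
  fast along every geodesic ray \<open>r\<close>, which yields a continuous map from the boundary to lines of \<open>\<complex>\<^sup>2\<^sup>m\<close>.
  This map is transverse: lines over distinct boundary points pair nontrivially under \<open>\<omega>\<close>.
  Otherwise the norm of a product along the quasi-geodesic joining the two points would lose a factor
  exponential in \<open>n\<close> whenever a segment of length \<open>2 n\<close> is cut in the middle. Iterating over dyadic scales,
  the norm over a segment of length \<open>2\<^sup>p\<close> would drop below 1, which is impossible for symplectic matrices.

  If a point \<open>z\<close> of the boundary lies outside an embedded 2-sphere, pairing with the line over \<open>z\<close> selects
  nonzero vectors \<open>y x\<close> on the lines over the points \<open>x\<close> of the sphere, continuously in \<open>x\<close>. Then
  \<open>\<omega> (y x) (y x')\<close> is alternating and vanishes only on the diagonal, so that evaluating it at pairs of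
  antipodal points gives an odd map from the sphere to \<open>\<complex> - {0}\<close>. Such a map has no continuous logarithm,
  although the sphere is simply connected.
\<close>

section \<open>Matrices close to rank one\<close>

text \<open>The identity behind the proof is g^T J h = J (g^-1 h) for symplectic g, where J is the
  matrix of the form: pairing the columns of two matrices yields a matrix with the norm of the group
  element between them. A vanishing pairing of limit lines, a statement at infinity, thus becomes a
  loss of norm along finite segments, and it can be read off from any base point. As the form
  identifies lines with hyperplanes, one limit map serves for both. The point z outside the sphere
  is essential: a uniform lattice in SL_2(C) = Sp_2(C) has a 2-sphere as its whole boundary, its
  limit map is a homeomorphism onto the complex projective line, and the tautological line bundle
  there has no nowhere vanishing continuous section. A point z transverse to the whole sphere
  supplies such a section over it. Lines are encoded by Hermitian projections and closeness to rank
  one by 2-by-2 minors. Both are explicit in the matrix entries, so convergence and continuity can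
  be checked entry by entry, without choosing singular vectors.\<close>

text \<open>Square matrices of size \<open>N\<close> are represented by their entry functions, of which only the arguments
  below \<open>N\<close> matter. A matrix is close to rank one if its 2-by-2 minors are small compared to its
  squared Frobenius norm, and then \<open>range_proj\<close> is close to the orthogonal projection onto
  its image line.\<close>

definition fro :: "nat \<Rightarrow> (nat \<Rightarrow> nat \<Rightarrow> complex) \<Rightarrow> real" where
  "fro N a = sqrt (\<Sum>i<N. \<Sum>j<N. (cmod (a i j))\<^sup>2)"

definition mmul :: "nat \<Rightarrow> (nat \<Rightarrow> nat \<Rightarrow> complex) \<Rightarrow> (nat \<Rightarrow> nat \<Rightarrow> complex) \<Rightarrow> nat \<Rightarrow> nat \<Rightarrow> complex" where
  "mmul N a b i j = (\<Sum>k<N. a i k * b k j)"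

definition minor_bound :: "nat \<Rightarrow> (nat \<Rightarrow> nat \<Rightarrow> complex) \<Rightarrow> real \<Rightarrow> bool" where
  "minor_bound N a e \<longleftrightarrow> (\<forall>i<N. \<forall>j<N. \<forall>k<N. \<forall>l<N.
     cmod (a i j * a k l - a i l * a k j) \<le> e * (fro N a)\<^sup>2)"

definition range_proj :: "nat \<Rightarrow> (nat \<Rightarrow> nat \<Rightarrow> complex) \<Rightarrow> nat \<Rightarrow> nat \<Rightarrow> complex" where
  "range_proj N a i j = (\<Sum>l<N. a i l * cnj (a j l)) / of_real ((fro N a)\<^sup>2)"

text \<open>The matrix a^T J b: its entries are the values of the form J on a column of
  \<open>a\<close> and a column of \<open>b\<close>. The transpose, not the adjoint, matches the
  bilinearity of the symplectic form.\<close>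

definition pairing :: "nat \<Rightarrow> (nat \<Rightarrow> nat \<Rightarrow> complex) \<Rightarrow> (nat \<Rightarrow> nat \<Rightarrow> complex) \<Rightarrow>
    (nat \<Rightarrow> nat \<Rightarrow> complex) \<Rightarrow> nat \<Rightarrow> nat \<Rightarrow> complex" where
  "pairing N J a b p q = (\<Sum>i<N. \<Sum>j<N. a i p * J i j * b j q)"

lemma cmod_sum_le: "(\<And>i. i < N \<Longrightarrow> cmod (f i) \<le> c) \<Longrightarrow> cmod (\<Sum>i<N. f i) \<le> real N * c"
  using sum_norm_bound[of "{..<N}" f c] by simp

lemma fro_nonneg [simp]: "0 \<le> fro N a"
  by (simp add: fro_def sum_nonneg)

lemma fro_sq: "(fro N a)\<^sup>2 = (\<Sum>i<N. \<Sum>j<N. (cmod (a i j))\<^sup>2)"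
  by (simp add: fro_def sum_nonneg)

lemma fro_sq_complex: "of_real ((fro N a)\<^sup>2) = (\<Sum>i<N. \<Sum>j<N. a i j * cnj (a i j))"
  by (simp only: fro_sq of_real_sum complex_norm_square)

lemma fro_cong: "(\<And>i j. i < N \<Longrightarrow> j < N \<Longrightarrow> cmod (a i j) = cmod (b i j)) \<Longrightarrow> fro N a = fro N b"
  by (simp add: fro_def)

lemma cmod_le_fro:
  assumes "i < N" "j < N" shows "cmod (a i j) \<le> fro N a"
proof -
  have "(cmod (a i j))\<^sup>2 \<le> (\<Sum>j<N. (cmod (a i j))\<^sup>2)"
    using assms by (intro member_le_sum) auto
  also have "\<dots> \<le> (\<Sum>i<N. \<Sum>j<N. (cmod (a i j))\<^sup>2)"
    using assms by (intro member_le_sum[of i _ "\<lambda>i. \<Sum>j<N. (cmod (a i j))\<^sup>2"]) (auto intro: sum_nonneg)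
  also have "\<dots> = (fro N a)\<^sup>2" by (simp add: fro_sq)
  finally show ?thesis by (rule power2_le_imp_le) simp
qed

lemma fro_le:
  assumes "\<And>i j. i < N \<Longrightarrow> j < N \<Longrightarrow> cmod (a i j) \<le> c" "0 \<le> c"
  shows "fro N a \<le> real N * c"
proof -
  have "(fro N a)\<^sup>2 \<le> (\<Sum>i<N. \<Sum>j<N. c\<^sup>2)"
    unfolding fro_sq by (intro sum_mono power_mono) (use assms in auto)
  also have "\<dots> = (real N * c)\<^sup>2" by (simp add: power_mult_distrib power2_eq_square)
  finally show ?thesis by (rule power2_le_imp_le) (use assms(2) in simp)
qed

lemma fro_mmul: "fro N (mmul N a b) \<le> fro N a * fro N b"
proof -
  have *: "(cmod (mmul N a b i j))\<^sup>2 \<le> (\<Sum>k<N. (cmod (a i k))\<^sup>2) * (\<Sum>k<N. (cmod (b k j))\<^sup>2)" for i j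
  proof -
    have "cmod (mmul N a b i j) \<le> (\<Sum>k<N. cmod (a i k) * cmod (b k j))"
      unfolding mmul_def by (rule sum_norm_le) (simp add: norm_mult)
    then have "(cmod (mmul N a b i j))\<^sup>2 \<le> (\<Sum>k<N. cmod (a i k) * cmod (b k j))\<^sup>2"
      by (intro power_mono) auto
    also have "\<dots> \<le> (\<Sum>k<N. (cmod (a i k))\<^sup>2) * (\<Sum>k<N. (cmod (b k j))\<^sup>2)"
      by (rule Cauchy_Schwarz_ineq_sum)
    finally show ?thesis .
  qed
  have "(fro N (mmul N a b))\<^sup>2 \<le> (\<Sum>i<N. \<Sum>j<N. (\<Sum>k<N. (cmod (a i k))\<^sup>2) * (\<Sum>k<N. (cmod (b k j))\<^sup>2))"
    unfolding fro_sq by (intro sum_mono *)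
  also have "\<dots> = (\<Sum>i<N. \<Sum>k<N. (cmod (a i k))\<^sup>2) * (\<Sum>j<N. \<Sum>k<N. (cmod (b k j))\<^sup>2)"
    by (simp add: sum_product)
  also have "(\<Sum>j<N. \<Sum>k<N. (cmod (b k j))\<^sup>2) = (\<Sum>k<N. \<Sum>j<N. (cmod (b k j))\<^sup>2)"
    by (rule sum.swap)
  finally have "(fro N (mmul N a b))\<^sup>2 \<le> (fro N a * fro N b)\<^sup>2"
    by (simp add: fro_sq power_mult_distrib)
  then show ?thesis by (rule power2_le_imp_le) simp
qed

lemma minor_boundD:
  "\<lbrakk>minor_bound N a e; i < N; j < N; k < N; l < N\<rbrakk> \<Longrightarrow>
    cmod (a i j * a k l - a i l * a k j) \<le> e * (fro N a)\<^sup>2"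
  unfolding minor_bound_def by blast

lemma minor_bound_mono:
  "minor_bound N a e \<Longrightarrow> e \<le> e' \<Longrightarrow> minor_bound N a e'"
  unfolding minor_bound_def by (meson mult_right_mono order_trans zero_le_power2)

text \<open>Multiplication on the right keeps the image of a rank-one matrix unless the product
  nearly vanishes. That is excluded by \<open>k'\<close>, which undoes \<open>k\<close> and so
  bounds the norm of \<open>a\<close> by that of the product times that of
  \<open>k'\<close>.\<close>

lemma range_proj_mmul_close:
  assumes mb: "minor_bound N a e" and e: "0 \<le> e"
    and a: "\<And>i j. i < N \<Longrightarrow> j < N \<Longrightarrow> a i j = mmul N (mmul N a k) k' i j"
    and pos: "0 < fro N a" and ij: "i < N" "j < N"
  shows "cmod (range_proj N (mmul N a k) i j - range_proj N a i j)
      \<le> 2 * real N ^ 4 * e * fro N k * fro N k'"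
proof -
  define b where "b = mmul N a k"
  define A B where "A = fro N a" and "B = fro N b"
  have AB: "A \<le> B * fro N k'"
  proof -
    have "A = fro N (mmul N b k')" unfolding A_def b_def using a by (intro fro_cong) simp
    then show ?thesis using fro_mmul B_def by metis
  qed
  have A0: "A > 0" using pos A_def by simp
  have B0: "B > 0"
  proof (rule ccontr)
    assume "\<not> B > 0"
    then have "B = 0" using B_def fro_nonneg[of N b] by simp
    then show False using AB A0 by simp
  qed
  \<comment> \<open>The columns of \<open>b\<close> are combinations of the columns of
    \<open>a\<close>, so a minor built from one column of each is a combination of minors of
    \<open>a\<close>.\<close>
  have key: "cmod (b i' p * a u v - a i' v * b u p) \<le> real N * (e * A\<^sup>2 * fro N k)"
    if "i' < N" "p < N" "u < N" "v < N" for i' p u v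
  proof -
    have "b i' p * a u v - a i' v * b u p = (\<Sum>q<N. (a i' q * a u v - a i' v * a u q) * k q p)"
      unfolding b_def mmul_def by (simp add: sum_distrib_right sum_distrib_left sum_subtractf[symmetric] algebra_simps)
    also have "cmod \<dots> \<le> real N * (e * A\<^sup>2 * fro N k)"
    proof (rule cmod_sum_le)
      fix q assume "q < N"
      then show "cmod ((a i' q * a u v - a i' v * a u q) * k q p) \<le> e * A\<^sup>2 * fro N k"
        unfolding norm_mult A_def using that e
        by (intro mult_mono minor_boundD[OF mb] cmod_le_fro) auto
    qed
    finally show ?thesis .
  qed
  have bd: "cmod (b i' p * a u v) \<le> B * A" "cmod (a i' v * b u p) \<le> A * B"
    if "i' < N" "p < N" "u < N" "v < N" for i' p u v
    unfolding norm_mult A_def B_def using that by (auto intro!: mult_mono cmod_le_fro)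
  define X where "X = (\<Sum>l<N. b i l * cnj (b j l))"
  define Y where "Y = (\<Sum>l<N. a i l * cnj (a j l))"
  have "X * of_real (A\<^sup>2) = (\<Sum>u<N. \<Sum>v<N. \<Sum>p<N. (b i p * cnj (b j p)) * (a u v * cnj (a u v)))"
    unfolding X_def A_def fro_sq_complex by (simp only: sum_distrib_left sum_distrib_right)
  also have "\<dots> = (\<Sum>u<N. \<Sum>p<N. \<Sum>v<N. (b i p * cnj (b j p)) * (a u v * cnj (a u v)))"
    by (rule sum.cong[OF refl], rule sum.swap)
  finally have X: "X * of_real (A\<^sup>2) = (\<Sum>u<N. \<Sum>p<N. \<Sum>v<N. (b i p * cnj (b j p)) * (a u v * cnj (a u v)))" .
  have Y: "Y * of_real (B\<^sup>2) = (\<Sum>u<N. \<Sum>p<N. \<Sum>v<N. (a i v * cnj (a j v)) * (b u p * cnj (b u p)))"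
    unfolding Y_def B_def fro_sq_complex by (simp only: sum_distrib_left sum_distrib_right)
  \<comment> \<open>Both sums run over the same indices: a row \<open>u\<close>, a column
    \<open>p\<close> of \<open>b\<close> and a column \<open>v\<close> of \<open>a\<close>. Each
    summand then compares products whose factors differ by mixed minors.\<close>
  have num: "X * of_real (A\<^sup>2) - Y * of_real (B\<^sup>2) = (\<Sum>u<N. \<Sum>p<N. \<Sum>v<N.
      (b i p * a u v) * cnj (b j p * a u v) - (a i v * b u p) * cnj (a j v * b u p))"
    unfolding X Y by (simp add: sum_subtractf[symmetric] algebra_simps)
  let ?E = "real N * (e * A\<^sup>2 * fro N k)"
  have E0: "0 \<le> ?E" using e by simp
  have summand: "cmod ((b i p * a u v) * cnj (b j p * a u v) - (a i v * b u p) * cnj (a j v * b u p))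
      \<le> 2 * (?E * (A * B))" if "p < N" "u < N" "v < N" for p u v
  proof -
    have "(b i p * a u v) * cnj (b j p * a u v) - (a i v * b u p) * cnj (a j v * b u p)
      = (b i p * a u v - a i v * b u p) * cnj (b j p * a u v)
       + (a i v * b u p) * cnj (b j p * a u v - a j v * b u p)"
      by (simp add: algebra_simps)
    also have "cmod \<dots> \<le> cmod (b i p * a u v - a i v * b u p) * cmod (b j p * a u v)
       + cmod (a i v * b u p) * cmod (b j p * a u v - a j v * b u p)"
      by (metis complex_mod_cnj norm_mult norm_triangle_ineq)
    also have "\<dots> \<le> ?E * (B * A) + (A * B) * ?E"
      using that ij A0 B0 E0 by (intro add_mono mult_mono key bd) auto
    finally show ?thesis by (simp add: algebra_simps)
  qed
  have "cmod (X * of_real (A\<^sup>2) - Y * of_real (B\<^sup>2)) \<le> real N * (real N * (real N * (2 * (?E * (A * B)))))"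
    unfolding num by (intro cmod_sum_le summand)
  also have "\<dots> = 2 * real N ^ 4 * e * fro N k * A ^ 3 * B" by (simp add: power2_eq_square power3_eq_cube power4_eq_xxxx)
  finally have N1: "cmod (X * of_real (A\<^sup>2) - Y * of_real (B\<^sup>2)) \<le> 2 * real N ^ 4 * e * fro N k * A ^ 3 * B" .
  have "range_proj N b i j - range_proj N a i j = (X * of_real (A\<^sup>2) - Y * of_real (B\<^sup>2)) / of_real (A\<^sup>2 * B\<^sup>2)"
    unfolding range_proj_def X_def[symmetric] Y_def[symmetric] A_def[symmetric] B_def[symmetric]
    using A0 B0 by (simp add: field_simps)
  also have "cmod \<dots> = cmod (X * of_real (A\<^sup>2) - Y * of_real (B\<^sup>2)) / (A\<^sup>2 * B\<^sup>2)"
    by (simp only: norm_divide norm_of_real) simp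
  also have "\<dots> \<le> 2 * real N ^ 4 * e * fro N k * A ^ 3 * B / (A\<^sup>2 * B\<^sup>2)"
    by (intro divide_right_mono N1) auto
  also have "\<dots> = 2 * real N ^ 4 * e * fro N k * (A / B)"
    using A0 B0 by (simp add: power2_eq_square power3_eq_cube)
  also have "\<dots> \<le> 2 * real N ^ 4 * e * fro N k * fro N k'"
    using AB B0 e by (intro mult_left_mono) (auto simp: divide_le_eq mult.commute)
  finally show ?thesis unfolding b_def .
qed

lemma cmod_range_proj_le:
  assumes "i < N" "j < N" shows "cmod (range_proj N a i j) \<le> real N"
proof (cases "fro N a = 0")
  case True then show ?thesis by (simp add: range_proj_def)
next
  case False
  then have pos: "0 < (fro N a)\<^sup>2" by simp
  have "cmod (\<Sum>l<N. a i l * cnj (a j l)) \<le> real N * (fro N a)\<^sup>2"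
    by (rule cmod_sum_le) (use assms in \<open>auto simp: norm_mult power2_eq_square intro!: mult_mono cmod_le_fro\<close>)
  then show ?thesis using pos
    by (simp add: range_proj_def norm_divide divide_le_eq norm_power)
qed

text \<open>A rank-one matrix is fixed by the projection onto its image. After multiplication by the
  squared norm, the defect becomes a sum of conjugated entries times minors.\<close>

lemma range_proj_mmul_self:
  assumes mb: "minor_bound N a e" and pos: "0 < fro N a" and ip: "i < N" "p < N"
  shows "cmod (a i p - mmul N (range_proj N a) a i p) \<le> (real N)\<^sup>2 * e * fro N a"
proof -
  let ?A = "fro N a"
  have "mmul N (range_proj N a) a i p * of_real (?A\<^sup>2) = (\<Sum>u<N. \<Sum>v<N. a i v * cnj (a u v) * a u p)"
    unfolding mmul_def range_proj_def sum_distrib_right[of _ _ "of_real (?A\<^sup>2)"]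
  proof (rule sum.cong[OF refl])
    fix u
    show "(\<Sum>l<N. a i l * cnj (a u l)) / of_real (?A\<^sup>2) * a u p * of_real (?A\<^sup>2)
        = (\<Sum>v<N. a i v * cnj (a u v) * a u p)"
      using pos by (simp add: sum_distrib_right[symmetric])
  qed
  then have "(a i p - mmul N (range_proj N a) a i p) * of_real (?A\<^sup>2)
     = (\<Sum>u<N. \<Sum>v<N. cnj (a u v) * (a i p * a u v - a i v * a u p))"
    unfolding left_diff_distrib fro_sq_complex
    by (simp add: sum_distrib_left sum_subtractf[symmetric] algebra_simps)
  also have "cmod \<dots> \<le> real N * (real N * (?A * (e * ?A\<^sup>2)))"
    unfolding norm_mult[symmetric]
    by (intro cmod_sum_le) (use ip in \<open>auto simp only: norm_mult complex_mod_cnj fro_nonneg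
        intro!: mult_mono cmod_le_fro minor_boundD[OF mb] norm_ge_zero\<close>)
  finally have "cmod (a i p - mmul N (range_proj N a) a i p) * ?A\<^sup>2 \<le> ((real N)\<^sup>2 * e * ?A) * ?A\<^sup>2"
    by (simp add: norm_mult norm_power power2_eq_square mult_ac)
  then show ?thesis using pos by simp
qed

section \<open>Pairings of matrices close to rank one\<close>

lemma cmod_pairing_le:
  assumes J: "\<And>i j. i < N \<Longrightarrow> j < N \<Longrightarrow> cmod (J i j) \<le> 1"
    and x: "\<And>i. i < N \<Longrightarrow> cmod (x i p) \<le> c" and y: "\<And>i. i < N \<Longrightarrow> cmod (y i q) \<le> d"
    and cd: "0 \<le> c" "0 \<le> d"
  shows "cmod (pairing N J x y p q) \<le> (real N)\<^sup>2 * (c * d)"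
proof -
  have "cmod (pairing N J x y p q) \<le> real N * (real N * ((c * 1) * d))"
    unfolding pairing_def
    by (intro cmod_sum_le) (use assms in \<open>auto simp only: norm_mult intro!: mult_mono mult_nonneg_nonneg norm_ge_zero\<close>)
  then show ?thesis by (simp add: power2_eq_square)
qed

lemma pairing_diff_left:
  "pairing N J (\<lambda>i j. x i j - x' i j) y p q = pairing N J x y p q - pairing N J x' y p q"
  by (simp add: pairing_def sum_subtractf[symmetric] algebra_simps)

lemma pairing_diff_right:
  "pairing N J x (\<lambda>i j. y i j - y' i j) p q = pairing N J x y p q - pairing N J x y' p q"
  by (simp add: pairing_def sum_subtractf[symmetric] algebra_simps)

lemma sum_swap4:
  "(\<Sum>i\<in>A. \<Sum>j\<in>B. \<Sum>u\<in>C. \<Sum>v\<in>D. f i j u v) = (\<Sum>u\<in>C. \<Sum>v\<in>D. \<Sum>i\<in>A. \<Sum>j\<in>B. (f i j u v :: complex))"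
proof -
  have "(\<Sum>i\<in>A. \<Sum>j\<in>B. \<Sum>u\<in>C. \<Sum>v\<in>D. f i j u v) = (\<Sum>i\<in>A. \<Sum>u\<in>C. \<Sum>j\<in>B. \<Sum>v\<in>D. f i j u v)"
    by (intro sum.cong refl sum.swap)
  also have "\<dots> = (\<Sum>u\<in>C. \<Sum>i\<in>A. \<Sum>v\<in>D. \<Sum>j\<in>B. f i j u v)"
    by (subst sum.swap) (intro sum.cong refl sum.swap)
  also have "\<dots> = (\<Sum>u\<in>C. \<Sum>v\<in>D. \<Sum>i\<in>A. \<Sum>j\<in>B. f i j u v)"
    by (intro sum.cong refl sum.swap)
  finally show ?thesis .
qed

lemma pairing_mmul:
  "pairing N J (mmul N P a) (mmul N Q b) p q
    = (\<Sum>u<N. \<Sum>v<N. a u p * pairing N J P Q u v * b v q)"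
proof -
  have "pairing N J (mmul N P a) (mmul N Q b) p q =
     (\<Sum>i<N. \<Sum>j<N. \<Sum>u<N. \<Sum>v<N. (P i u * a u p) * J i j * (Q j v * b v q))"
    unfolding pairing_def mmul_def sum_distrib_left sum_distrib_right
    by (rule sum.cong[OF refl], rule sum.cong[OF refl], rule sum.swap)
  also have "\<dots> = (\<Sum>u<N. \<Sum>v<N. \<Sum>i<N. \<Sum>j<N. (P i u * a u p) * J i j * (Q j v * b v q))"
    by (rule sum_swap4)
  also have "\<dots> = (\<Sum>u<N. \<Sum>v<N. a u p * pairing N J P Q u v * b v q)"
    unfolding pairing_def sum_distrib_left sum_distrib_right by (intro sum.cong refl) (simp add: mult_ac)
  finally show ?thesis .
qed

text \<open>Up to errors governed by the minors, \<open>a\<close> and \<open>b\<close> may be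
  replaced by their products with the projections, and then the pairing of the projections is the
  middle factor. Image lines that nearly annihilate each other thus make a^T J b much smaller than
  the product of the norms.\<close>

lemma fro_pairing_le:
  assumes J: "\<And>i j. i < N \<Longrightarrow> j < N \<Longrightarrow> cmod (J i j) \<le> 1"
    and ma: "minor_bound N a ea" and mb: "minor_bound N b eb"
    and e: "0 \<le> ea" "0 \<le> eb" and t: "0 \<le> t" and pos: "0 < fro N a" "0 < fro N b"
    and T: "\<And>p q. p < N \<Longrightarrow> q < N \<Longrightarrow> cmod (pairing N J (range_proj N a) (range_proj N b) p q) \<le> t"
  shows "fro N (pairing N J a b) \<le> real N ^ 7 * (t + ea + eb) * (fro N a * fro N b)"
proof -
  let ?A = "fro N a" and ?B = "fro N b"
  let ?a = "mmul N (range_proj N a) a" and ?b = "mmul N (range_proj N b) b"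
  have entry: "cmod (pairing N J a b p q) \<le> real N ^ 6 * (t + ea + eb) * (?A * ?B)" if pq: "p < N" "q < N" for p q
  proof -
    from pq have N1: "1 \<le> real N" by simp
    have split: "pairing N J a b p q = pairing N J ?a ?b p q
       + pairing N J ?a (\<lambda>i j. b i j - ?b i j) p q + pairing N J (\<lambda>i j. a i j - ?a i j) b p q"
      by (simp add: pairing_diff_left pairing_diff_right)
    have 1: "cmod (pairing N J ?a ?b p q) \<le> real N * (real N * (?A * t * ?B))"
      unfolding pairing_mmul
      by (intro cmod_sum_le) (use pq t pos in \<open>auto simp only: norm_mult
         intro!: mult_mono mult_nonneg_nonneg norm_ge_zero T cmod_le_fro fro_nonneg\<close>)
    have Pa: "cmod (?a i p) \<le> (real N)\<^sup>2 * ?A" if "i < N" for i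
    proof -
      have "cmod (?a i p) \<le> real N * (real N * ?A)"
        unfolding mmul_def by (intro cmod_sum_le) (use pq that in \<open>auto simp only: norm_mult
           intro!: mult_mono cmod_range_proj_le cmod_le_fro fro_nonneg norm_ge_zero of_nat_0_le_iff\<close>)
      then show ?thesis by (simp add: power2_eq_square)
    qed
    \<comment> \<open>This term decides the exponent: two powers of \<open>real N\<close> each from
      the double sum, from the crude bound \<open>Pa\<close> and from the defect of
      \<open>b\<close>. A seventh comes from \<open>fro_le\<close> at the end.\<close>
    have 2: "cmod (pairing N J ?a (\<lambda>i j. b i j - ?b i j) p q)
         \<le> (real N)\<^sup>2 * (((real N)\<^sup>2 * ?A) * ((real N)\<^sup>2 * eb * ?B))"
      using e pq pos by (intro cmod_pairing_le J Pa range_proj_mmul_self[OF mb]) auto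
    have 3: "cmod (pairing N J (\<lambda>i j. a i j - ?a i j) b p q)
         \<le> (real N)\<^sup>2 * (((real N)\<^sup>2 * ea * ?A) * ?B)"
      using e pq pos by (intro cmod_pairing_le J cmod_le_fro range_proj_mmul_self[OF ma]) auto
    have "cmod (pairing N J a b p q) \<le> (real N ^ 2 * t + real N ^ 6 * eb + real N ^ 4 * ea) * (?A * ?B)"
      unfolding split using 1 2 3
      by (intro order_trans[OF norm_triangle_ineq] order_trans[OF add_mono[OF norm_triangle_ineq order_refl]])
        (simp add: algebra_simps power_numeral_reduce power2_eq_square)
    also have "\<dots> \<le> (real N ^ 6 * t + real N ^ 6 * eb + real N ^ 6 * ea) * (?A * ?B)"
      using e t pos N1 by (intro mult_right_mono add_mono power_increasing) auto
    finally show ?thesis by (simp add: algebra_simps)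
  qed
  have "fro N (pairing N J a b) \<le> real N * (real N ^ 6 * (t + ea + eb) * (?A * ?B))"
    using entry e t pos by (intro fro_le) auto
  then show ?thesis by (simp add: algebra_simps power_numeral_reduce)
qed

text \<open>Converse to \<open>fro_pairing_le\<close>: the projection is a multiple of
  \<open>a\<close> times its adjoint, so a^T J b is the middle factor of the pairing of the
  projections. The two directions together carry smallness of a pairing from one base point to
  another.\<close>

lemma pairing_range_proj_le:
  assumes pos: "0 < fro N a" "0 < fro N b" and pq: "p < N" "q < N"
  shows "cmod (pairing N J (range_proj N a) (range_proj N b) p q)
     \<le> (real N)\<^sup>2 * (fro N (pairing N J a b) / (fro N a * fro N b))"
proof -
  let ?A = "fro N a" and ?B = "fro N b" and ?W = "pairing N J a b"
  let ?S = "\<Sum>s<N. \<Sum>t<N. cnj (a p s) * ?W s t * cnj (b q t)"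
  have "pairing N J (range_proj N a) (range_proj N b) p q
     = pairing N J (mmul N a (\<lambda>l p. cnj (a p l))) (mmul N b (\<lambda>l p. cnj (b p l))) p q / of_real (?A\<^sup>2 * ?B\<^sup>2)"
    unfolding pairing_def range_proj_def mmul_def sum_divide_distrib[of _ _ "of_real (?A\<^sup>2 * ?B\<^sup>2)"]
    by (rule sum.cong[OF refl], rule sum.cong[OF refl]) simp
  then have eq: "pairing N J (range_proj N a) (range_proj N b) p q = ?S / of_real (?A\<^sup>2 * ?B\<^sup>2)"
    by (simp only: pairing_mmul)
  have S: "cmod ?S \<le> real N * (real N * (?A * fro N ?W * ?B))"
  proof (intro cmod_sum_le)
    fix s t assume "s < N" "t < N"
    then show "cmod (cnj (a p s) * ?W s t * cnj (b q t)) \<le> ?A * fro N ?W * ?B"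
      unfolding norm_mult complex_mod_cnj using pq by (intro mult_mono cmod_le_fro) auto
  qed
  have "cmod (?S / of_real (?A\<^sup>2 * ?B\<^sup>2)) = cmod ?S / (?A\<^sup>2 * ?B\<^sup>2)"
    by (simp only: norm_divide norm_of_real) simp
  also have "\<dots> \<le> real N * (real N * (?A * fro N ?W * ?B)) / (?A\<^sup>2 * ?B\<^sup>2)"
    by (rule divide_right_mono[OF S]) simp
  also have "\<dots> = (real N)\<^sup>2 * (fro N ?W / (?A * ?B))"
    using pos by (simp add: power2_eq_square field_simps)
  finally show ?thesis unfolding eq .
qed

lemma range_proj_hermitian: "cnj (range_proj N a j i) = range_proj N a i j"
  by (simp add: range_proj_def mult_ac)

text \<open>The minors of \<open>a\<close> times its adjoint are sums of products of entries with
  conjugated minors of \<open>a\<close>. Limits of the projections will therefore satisfy the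
  rank-one identities exactly.\<close>

lemma range_proj_minor:
  assumes mb: "minor_bound N a e" and pos: "0 < fro N a" and ij: "i < N" "j < N" "k < N" "l < N"
  shows "cmod (range_proj N a i j * range_proj N a k l - range_proj N a i l * range_proj N a k j)
     \<le> (real N)\<^sup>2 * e"
proof -
  let ?A = "fro N a" and ?P = "range_proj N a"
  let ?X = "\<lambda>i j. \<Sum>p<N. a i p * cnj (a j p)"
  have eq: "?P i j * ?P k l - ?P i l * ?P k j = (?X i j * ?X k l - ?X i l * ?X k j) / of_real (?A ^ 4)"
  proof -
    have "w / c * (x / c) - y / c * (z / c) = (w * x - y * z) / c\<^sup>2" for w x y z c :: complex
      by (simp add: diff_divide_distrib power2_eq_square)
    then show ?thesis unfolding range_proj_def by (simp flip: of_real_power)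
  qed
  let ?S = "\<Sum>p<N. \<Sum>q<N. a i p * a k q * cnj (a j p * a l q - a j q * a l p)"
  have X: "?X i j * ?X k l - ?X i l * ?X k j = ?S"
    unfolding sum_product sum_subtractf[symmetric]
    by (simp only: complex_cnj_diff complex_cnj_mult right_diff_distrib mult_ac)
  have S: "cmod ?S \<le> real N * (real N * ((?A * ?A) * (e * ?A\<^sup>2)))"
  proof (intro cmod_sum_le)
    fix p q assume "p < N" "q < N"
    then show "cmod (a i p * a k q * cnj (a j p * a l q - a j q * a l p)) \<le> (?A * ?A) * (e * ?A\<^sup>2)"
      unfolding norm_mult complex_mod_cnj using ij by (intro mult_mono cmod_le_fro minor_boundD[OF mb]) auto
  qed
  have "cmod (?S / of_real (?A ^ 4)) = cmod ?S / ?A ^ 4"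
    by (simp only: norm_divide norm_of_real) simp
  also have "\<dots> \<le> real N * (real N * ((?A * ?A) * (e * ?A\<^sup>2))) / ?A ^ 4"
    by (rule divide_right_mono[OF S]) simp
  also have "\<dots> = (real N)\<^sup>2 * e"
    using pos by (simp add: power2_eq_square power4_eq_xxxx)
  finally show ?thesis unfolding eq X .
qed

lemma range_proj_cong:
  assumes "\<And>i j. i < N \<Longrightarrow> j < N \<Longrightarrow> a i j = b i j" "i < N" "j < N"
  shows "range_proj N a i j = range_proj N b i j"
proof -
  have "fro N a = fro N b" by (rule fro_cong) (simp add: assms(1))
  then show ?thesis unfolding range_proj_def using assms by simp
qed

lemma geometric_tail:
  fixes x :: "nat \<Rightarrow> complex"
  assumes step: "\<And>n. cmod (x (Suc n) - x n) \<le> C * q ^ n" and q: "0 < q" "q < 1" and le: "n \<le> M"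
  shows "cmod (x M - x n) \<le> C / (1 - q) * q ^ n"
proof -
  have C: "0 \<le> C" using step[of 0] norm_ge_zero[of "x (Suc 0) - x 0"] by (simp del: norm_ge_zero)
  \<comment> \<open>Subtracting \<open>q ^ M\<close> makes the estimate telescope, so that the
    induction closes.\<close>
  have "cmod (x M - x n) \<le> C / (1 - q) * (q ^ n - q ^ M)"
    using le
  proof (induction M rule: dec_induct)
    case base then show ?case by simp
  next
    case (step M)
    have "cmod (x (Suc M) - x n) \<le> cmod (x (Suc M) - x M) + cmod (x M - x n)"
      by (metis diff_add_cancel add_diff_eq norm_triangle_ineq)
    also have "\<dots> \<le> C * q ^ M + C / (1 - q) * (q ^ n - q ^ M)"
      using assms(1)[of M] step.IH by simp
    also have "\<dots> = C / (1 - q) * (q ^ n - q ^ Suc M)"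
      using q by (simp add: field_simps)
    finally show ?case .
  qed
  also have "\<dots> \<le> C / (1 - q) * q ^ n"
    using C q by (intro mult_left_mono) auto
  finally show ?thesis .
qed

lemma pairing_close:
  assumes J: "\<And>i j. i < N \<Longrightarrow> j < N \<Longrightarrow> cmod (J i j) \<le> 1" and pq: "p < N" "q < N"
    and x: "\<And>i j. i < N \<Longrightarrow> j < N \<Longrightarrow> cmod (x i j - x' i j) \<le> d"
    and y: "\<And>i j. i < N \<Longrightarrow> j < N \<Longrightarrow> cmod (y i j - y' i j) \<le> d"
    and x': "\<And>i j. i < N \<Longrightarrow> j < N \<Longrightarrow> cmod (x' i j) \<le> B"
    and y0: "\<And>i j. i < N \<Longrightarrow> j < N \<Longrightarrow> cmod (y i j) \<le> B"
  shows "cmod (pairing N J x y p q - pairing N J x' y' p q) \<le> 2 * (real N)\<^sup>2 * B * d"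
proof -
  have d: "0 \<le> d" using x[OF pq] norm_ge_zero order_trans by blast
  have B: "0 \<le> B" using x'[OF pq] norm_ge_zero order_trans by blast
  have "pairing N J x y p q - pairing N J x' y' p q
     = pairing N J (\<lambda>i j. x i j - x' i j) y p q + pairing N J x' (\<lambda>i j. y i j - y' i j) p q"
    by (simp add: pairing_diff_left pairing_diff_right)
  also have "cmod \<dots> \<le> (real N)\<^sup>2 * (d * B) + (real N)\<^sup>2 * (B * d)"
    using pq d B by (intro norm_triangle_mono cmod_pairing_le J x y x' y0)
  finally show ?thesis by (simp add: algebra_simps)
qed

lemma geometric_limit:
  fixes x :: "nat \<Rightarrow> complex"
  assumes step: "\<And>n. cmod (x (Suc n) - x n) \<le> C * q ^ n" and q: "0 < q" "q < 1"
  shows "x \<longlonglongrightarrow> lim x" "cmod (x n - lim x) \<le> C / (1 - q) * q ^ n"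
proof -
  note tail = geometric_tail[OF step q]
  have C: "0 \<le> C" using step[of 0] norm_ge_zero[of "x (Suc 0) - x 0"] by (simp del: norm_ge_zero)
  have "Cauchy x"
  proof (rule metric_CauchyI)
    fix e :: real assume e: "0 < e"
    have "(\<lambda>n. C / (1 - q) * q ^ n) \<longlonglongrightarrow> C / (1 - q) * 0"
      using q by (intro tendsto_intros LIMSEQ_power_zero) auto
    then have "\<forall>\<^sub>F n in sequentially. C / (1 - q) * q ^ n < e / 2"
      by (rule order_tendstoD) (use e in simp)
    then obtain n where n: "C / (1 - q) * q ^ n < e / 2" by (auto simp: eventually_sequentially)
    have close: "dist (x M) (x n) < e / 2" if "n \<le> M" for M
      using tail[OF that] n unfolding dist_norm by linarith
    then show "\<exists>M. \<forall>m\<ge>M. \<forall>n\<ge>M. dist (x m) (x n) < e"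
      by (meson dist_triangle_half_l dist_commute close)
  qed
  then have "convergent x" by (rule Cauchy_convergent)
  then show l: "x \<longlonglongrightarrow> lim x" by (simp add: convergent_LIMSEQ_iff)
  have "(\<lambda>M. cmod (x M - x n)) \<longlonglongrightarrow> cmod (lim x - x n)" by (intro tendsto_intros l)
  then have "cmod (lim x - x n) \<le> C / (1 - q) * q ^ n"
    by (rule Lim_bounded[where M = n]) (use tail in auto)
  then show "cmod (x n - lim x) \<le> C / (1 - q) * q ^ n" by (simp add: norm_minus_commute)
qed

lemma pairing_mmul_right: "pairing N J a (mmul N b c) p q = mmul N (pairing N J a b) c p q"
proof -
  have "pairing N J a (mmul N b c) p q = (\<Sum>i<N. \<Sum>j<N. \<Sum>k<N. a i p * J i j * b j k * c k q)"
    unfolding pairing_def mmul_def sum_distrib_left by (simp only: mult.assoc)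
  also have "\<dots> = (\<Sum>i<N. \<Sum>k<N. \<Sum>j<N. a i p * J i j * b j k * c k q)"
    by (rule sum.cong[OF refl], rule sum.swap)
  also have "\<dots> = (\<Sum>k<N. \<Sum>i<N. \<Sum>j<N. a i p * J i j * b j k * c k q)"
    by (rule sum.swap)
  also have "\<dots> = mmul N (pairing N J a b) c p q"
    by (simp add: pairing_def mmul_def sum_distrib_right)
  finally show ?thesis .
qed

lemma fro_transpose: "fro N (\<lambda>i j. a j i) = fro N a"
proof -
  have "(\<Sum>i<N. \<Sum>j<N. (cmod (a j i))\<^sup>2) = (\<Sum>i<N. \<Sum>j<N. (cmod (a i j))\<^sup>2)" by (rule sum.swap)
  then show ?thesis by (simp add: fro_def)
qed

lemma pairing_eq_mmul: "pairing N J a b p q = mmul N (\<lambda>p i. a i p) (mmul N J b) p q"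
  by (simp add: pairing_def mmul_def sum_distrib_left mult.assoc)

lemma pairing_skew:
  assumes "\<And>i j. i < N \<Longrightarrow> j < N \<Longrightarrow> J j i = - J i j"
  shows "pairing N J b a q p = - pairing N J a b p q"
proof -
  have "pairing N J b a q p = (\<Sum>i<N. \<Sum>j<N. b j q * J j i * a i p)"
    unfolding pairing_def by (rule sum.swap)
  also have "\<dots> = (\<Sum>i<N. \<Sum>j<N. - (a i p * J i j * b j q))"
  proof (intro sum.cong refl)
    fix i j assume "i \<in> {..<N}" "j \<in> {..<N}"
    then show "b j q * J j i * a i p = - (a i p * J i j * b j q)" using assms[of i j] by simp
  qed
  finally show ?thesis by (simp add: pairing_def sum_negf)
qed

text \<open>As P is Hermitian, the conjugate of row c of Z^T J P is P applied to a vector, hence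
  lies on the line of P; without the conjugation it would lie on the conjugate line. Proportionality
  to the columns of P is written in cross-multiplied form, which avoids naming a scalar.\<close>

lemma vec_pairing_lift:
  fixes P Q Z :: "nat \<Rightarrow> nat \<Rightarrow> complex"
  assumes herm: "\<And>i j. i < N \<Longrightarrow> j < N \<Longrightarrow> cnj (P j i) = P i j"
    and minor: "\<And>i j k l. i < N \<Longrightarrow> j < N \<Longrightarrow> k < N \<Longrightarrow> l < N \<Longrightarrow> P i j * P k l = P i l * P k j"
    and ij: "i < N" "j < N" "k < N"
  shows "P i j * cnj (pairing N J Z P c k) = cnj (pairing N J Z P c i) * P k j"
proof -
  have lift: "cnj (pairing N J Z P c i) = (\<Sum>l<N. P i l * (\<Sum>u<N. cnj (Z u c * J u l)))" if "i < N" for i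
    unfolding pairing_def cnj_sum
    by (subst sum.swap) (use herm that in \<open>auto simp: sum_distrib_left intro!: sum.cong\<close>)
  show ?thesis
    unfolding lift[OF ij(1)] lift[OF ij(3)] sum_distrib_left sum_distrib_right
  proof (intro sum.cong refl)
    fix l u assume "l \<in> {..<N}"
    then have "P i j * P k l = P i l * P k j" using minor ij by simp
    then show "P i j * (P k l * cnj (Z u c * J u l)) = P i l * cnj (Z u c * J u l) * P k j"
      by (metis mult.assoc mult.commute)
  qed
qed

text \<open>All columns of a rank-one Z are proportional, so any nonzero column detects a
  nonvanishing pairing. This permits one column index to be fixed for all points of the
  sphere.\<close>

lemma pairing_column_nonzero:
  assumes minor: "\<And>i j k l. i < N \<Longrightarrow> j < N \<Longrightarrow> k < N \<Longrightarrow> l < N \<Longrightarrow> Z i j * Z k l = Z i l * Z k j"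
    and nz: "pairing N J Z P p q \<noteq> 0" "p < N" and c: "Z k c \<noteq> 0" "k < N" "c < N"
  shows "pairing N J Z P c q \<noteq> 0"
proof -
  have "pairing N J Z P p q * Z k c = pairing N J Z P c q * Z k p"
    unfolding pairing_def sum_distrib_right
  proof (intro sum.cong refl)
    fix i j assume "i \<in> {..<N}"
    then have "Z i p * Z k c = Z i c * Z k p" using minor nz(2) c by simp
    then show "Z i p * J i j * P j q * Z k c = Z i c * J i j * P j q * Z k p"
      by (metis mult.assoc mult.commute)
  qed
  then show ?thesis using nz c by auto
qed

text \<open>Vectors proportional to the columns of P and Q inherit transversality from them:
  multiplying the pairing of columns by entries of x and y turns it into a multiple of the pairing
  of x and y.\<close>

lemma lifted_pairing_nonzero:
  assumes x: "\<And>i j k. i < N \<Longrightarrow> j < N \<Longrightarrow> k < N \<Longrightarrow> P i j * x k = x i * P k j"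
    and y: "\<And>i j k. i < N \<Longrightarrow> j < N \<Longrightarrow> k < N \<Longrightarrow> Q i j * y k = y i * Q k j"
    and nz: "pairing N J P Q p q \<noteq> 0" "p < N" "q < N" and k: "x k \<noteq> 0" "k < N" and l: "y l \<noteq> 0" "l < N"
  shows "(\<Sum>i<N. \<Sum>j<N. x i * J i j * y j) \<noteq> 0"
proof -
  have "pairing N J P Q p q * (x k * y l) = P k p * Q l q * (\<Sum>i<N. \<Sum>j<N. x i * J i j * y j)"
    unfolding pairing_def sum_distrib_left sum_distrib_right
  proof (intro sum.cong refl)
    fix i j assume "i \<in> {..<N}" "j \<in> {..<N}"
    then have "P i p * x k = x i * P k p" "Q j q * y l = y j * Q l q" using x y nz k l by auto
    then show "P i p * J i j * Q j q * (x k * y l) = P k p * Q l q * (x i * J i j * y j)"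
      by (metis mult.assoc mult.commute)
  qed
  then show ?thesis using nz k l by auto
qed

section \<open>Transversality along a quasi-geodesic line\<close>

lemma doubling_contradiction:
  fixes f :: "int \<Rightarrow> int \<Rightarrow> real"
  assumes nonneg: "\<And>i j. 0 \<le> f i j" and sym: "\<And>i j. f i j = f j i" and step: "\<And>i. f i (i + 1) \<le> L"
    and mu: "0 < \<mu>" and A: "0 \<le> A"
    and doubling: "\<And>k n. f (k - int n) (k + int n) \<le> A - \<mu> * real n + f k (k - int n) + f k (k + int n)"
  shows False
proof -
  \<comment> \<open>Doubling the length saves \<open>\<mu> * 2 ^ p\<close> on a segment of length
    2^(p+1), which lowers the cost per unit length by half of \<mu>. The final \<open>- A\<close>
    reproduces itself, since -2A + A = -A.\<close>
  have bound: "f i (i + 2 ^ p) \<le> 2 ^ p * (L + A - real p * \<mu> / 2) - A" for p i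
  proof (induction p arbitrary: i)
    case 0 show ?case using step[of i] by simp
  next
    case (Suc p)
    let ?k = "i + 2 ^ p"
    have "f i (i + 2 ^ Suc p) = f (?k - int (2 ^ p)) (?k + int (2 ^ p))" by (simp add: algebra_simps)
    also have "\<dots> \<le> A - \<mu> * real (2 ^ p) + f ?k (?k - int (2 ^ p)) + f ?k (?k + int (2 ^ p))"
      by (rule doubling)
    also have "\<dots> = A - \<mu> * 2 ^ p + f i (i + 2 ^ p) + f ?k (?k + 2 ^ p)"
      using sym[of ?k i] by simp
    also have "\<dots> \<le> A - \<mu> * 2 ^ p + (2 ^ p * (L + A - real p * \<mu> / 2) - A) + (2 ^ p * (L + A - real p * \<mu> / 2) - A)"
      by (intro add_mono order_refl Suc.IH)
    also have "\<dots> = 2 ^ Suc p * (L + A - real (Suc p) * \<mu> / 2) - A"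
      by (simp add: algebra_simps)
    finally show ?case .
  qed
  obtain p :: nat where p: "(L + A) * 2 / \<mu> < real p" using reals_Archimedean2 by blast
  then have "L + A - real p * \<mu> / 2 < 0" using mu by (simp add: field_simps)
  then have "2 ^ p * (L + A - real p * \<mu> / 2) < 0" by (simp add: mult_pos_neg)
  then show False using bound[of 0 p] nonneg[of 0 "0 + 2 ^ p"] A by linarith
qed

text \<open>In the application \<open>h i j\<close> is the matrix of the group element leading from
  the i-th to the j-th point of a bi-infinite path. By \<open>lim\<close> the end lines seen from
  position 0 pair to zero. This is carried to every base point, then to finite distances with
  exponential precision, where it becomes the loss of norm.\<close>

lemma line_not_degenerate:
  fixes h :: "int \<Rightarrow> int \<Rightarrow> nat \<Rightarrow> nat \<Rightarrow> complex"
  assumes J: "\<And>i j. i < N \<Longrightarrow> j < N \<Longrightarrow> cmod (J i j) \<le> 1"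
    and one: "\<And>i j. 1 \<le> fro N (h i j)"
    and sym: "\<And>i j. fro N (h i j) = fro N (h j i)"
    and pair: "\<And>i j k. fro N (pairing N J (h k i) (h k j)) = fro N (h i j)"
    and mul: "\<And>i j k a b. a < N \<Longrightarrow> b < N \<Longrightarrow> h i k a b = mmul N (h i j) (h j k) a b"
    and step: "\<And>i. fro N (h i (i + 1)) \<le> K"
    and q: "0 < q" "q < 1" and c: "0 \<le> c"
    and minor: "\<And>i j. minor_bound N (h i j) (c * q ^ nat \<bar>i - j\<bar>)"
    and lim: "\<And>a b. a < N \<Longrightarrow> b < N \<Longrightarrow>
       (\<lambda>n. pairing N J (range_proj N (h 0 (- int n))) (range_proj N (h 0 (int n))) a b) \<longlonglongrightarrow> 0"
  shows False
proof -
  define R where "R k j = range_proj N (h k j)" for k j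
  define n where "n i j = fro N (h i j)" for i j
  have n1: "1 \<le> n i j" for i j using one n_def by simp
  have n0: "0 < n i j" for i j using n1[of i j] by linarith
  have nmul: "n i k \<le> n i j * n j k" for i j k
  proof -
    have "n i k = fro N (mmul N (h i j) (h j k))"
      unfolding n_def by (rule fro_cong) (simp add: mul[of _ _ i k j])
    then show ?thesis using fro_mmul n_def by metis
  qed
  have nsym: "n i j = n j i" for i j using sym n_def by simp
  have K1: "1 \<le> K" using one step order_trans by blast
  have K: "n i j \<le> K" if "\<bar>i - j\<bar> = 1" for i j
  proof -
    from that have "j = i + 1 \<or> i = j + 1" by linarith
    then show ?thesis using step nsym unfolding n_def by metis
  qed
  define D where "D = 2 * real N ^ 4 * c * K * K"
  have Rstep: "cmod (R k j' a b - R k j a b) \<le> D * q ^ nat \<bar>k - j\<bar>"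
    if "\<bar>j - j'\<bar> = 1" "a < N" "b < N" for k j j' a b
  proof -
    have "cmod (range_proj N (mmul N (h k j) (h j j')) a b - range_proj N (h k j) a b)
       \<le> 2 * real N ^ 4 * (c * q ^ nat \<bar>k - j\<bar>) * n j j' * n j' j"
      unfolding n_def
    proof (rule range_proj_mmul_close[OF minor])
      show "0 \<le> c * q ^ nat \<bar>k - j\<bar>" using c q by simp
      show "h k j i' b' = mmul N (mmul N (h k j) (h j j')) (h j' j) i' b'" if "i' < N" "b' < N" for i' b'
      proof -
        have "h k j i' b' = mmul N (h k j') (h j' j) i' b'" by (rule mul[OF that])
        also have "\<dots> = mmul N (mmul N (h k j) (h j j')) (h j' j) i' b'"
          unfolding mmul_def[of N _ "h j' j"] using that by (simp add: mul[of _ _ k j' j])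
        finally show ?thesis .
      qed
    qed (use that n0 n_def in auto)
    also have "\<dots> \<le> 2 * real N ^ 4 * (c * q ^ nat \<bar>k - j\<bar>) * K * K"
      using K[of j j'] K[of j' j] that c q n0[of j' j] K1 by (intro mult_mono mult_left_mono) auto
    finally show ?thesis
      unfolding R_def D_def using range_proj_cong[OF mul[of _ _ k j' j] that(2,3)]
      by (simp add: mult_ac)
  qed
  define E where "E = D / (1 - q)"
  have E0: "0 \<le> E" unfolding E_def D_def using c K1 q by simp
  have tailp: "cmod (R k (k + int M) a b - R k (k + int l) a b) \<le> E * q ^ l"
    if "l \<le> M" "a < N" "b < N" for k M l a b
    unfolding E_def
  proof (rule geometric_tail[of "\<lambda>M. R k (k + int M) a b", OF _ q that(1)])
    show "cmod (R k (k + int (Suc n)) a b - R k (k + int n) a b) \<le> D * q ^ n" for n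
      using Rstep[of "k + int n" "k + int (Suc n)" a b k] that by simp
  qed
  have tailm: "cmod (R k (k - int M) a b - R k (k - int l) a b) \<le> E * q ^ l"
    if "l \<le> M" "a < N" "b < N" for k M l a b
    unfolding E_def
  proof (rule geometric_tail[of "\<lambda>M. R k (k - int M) a b", OF _ q that(1)])
    show "cmod (R k (k - int (Suc n)) a b - R k (k - int n) a b) \<le> D * q ^ n" for n
      using Rstep[of "k - int n" "k - int (Suc n)" a b k] that by simp
  qed
  have RB: "cmod (R k j a b) \<le> real N" if "a < N" "b < N" for k j a b
    unfolding R_def using that by (rule cmod_range_proj_le)
  define T where "T k i j = pairing N J (R k i) (R k j)" for k i j
  \<comment> \<open>By \<open>pair\<close> the norm of the pairing does not depend on the base
    point, and passing from base \<open>k\<close> to base 0 raises the norm of each of the two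
    segments by a factor of at most \<open>n 0 k\<close>. So the ends pair to zero when seen from
    \<open>k\<close> as well.\<close>
  have T_small: "\<forall>\<^sub>F M in sequentially. \<forall>a<N. \<forall>b<N. cmod (T k (- int M) (int M) a b) \<le> \<eta>" if "\<eta> > 0" for k \<eta>
  proof -
    \<comment> \<open>The exponent 9 is 7 from \<open>fro_pairing_le\<close> plus 2 from
      \<open>pairing_range_proj_le\<close>, and \<open>1 + 2 * c\<close> arises because both minor
      errors are at most \<open>c * e\<close>. The last summand keeps \<open>Q\<close>
      positive.\<close>
    define Q where "Q = real N ^ 9 * (n 0 k)\<^sup>2 * (1 + 2 * c) + 1"
    have Q0: "Q > 0" unfolding Q_def using c by (intro add_nonneg_pos) auto
    define e where "e = \<eta> / Q"
    have e0: "e > 0" using that Q0 e_def by simp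
    have "\<forall>\<^sub>F M in sequentially. q ^ M < e"
      using order_tendstoD(2)[OF LIMSEQ_power_zero[of q]] q e0 by simp
    moreover have "\<forall>\<^sub>F M in sequentially. cmod (T 0 (- int M) (int M) a b) < e" if "a < N" "b < N" for a b
      using order_tendstoD(2)[OF tendsto_norm_zero[OF lim[OF that]] e0] unfolding T_def R_def .
    then have "\<forall>\<^sub>F M in sequentially. \<forall>a\<in>{..<N}. \<forall>b\<in>{..<N}. cmod (T 0 (- int M) (int M) a b) < e"
      by (intro eventually_ball_finite ballI) auto
    ultimately show ?thesis
    proof eventually_elim
      case (elim M)
      let ?i = "- int M" and ?j = "int M"
      have "fro N (pairing N J (h 0 ?i) (h 0 ?j)) \<le> real N ^ 7 * (e + c * q ^ nat \<bar>0 - ?i\<bar> + c * q ^ nat \<bar>0 - ?j\<bar>)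
           * (fro N (h 0 ?i) * fro N (h 0 ?j))"
      proof (rule fro_pairing_le[OF J minor minor])
        show "cmod (pairing N J (range_proj N (h 0 ?i)) (range_proj N (h 0 ?j)) a b) \<le> e"
          if "a < N" "b < N" for a b
          using elim(2) that unfolding T_def R_def by (simp add: less_imp_le)
      qed (use c q e0 n0 n_def in auto)
      then have "n ?i ?j \<le> real N ^ 7 * (e + 2 * c * q ^ M) * (n 0 ?i * n 0 ?j)"
        unfolding pair n_def[symmetric] by (simp add: algebra_simps)
      also have "\<dots> \<le> real N ^ 7 * (e + 2 * c * e) * (n 0 ?i * n 0 ?j)"
        using elim(1) c n0[of 0 ?i] n0[of 0 ?j] by (intro mult_right_mono mult_left_mono add_left_mono) auto
      also have "\<dots> \<le> real N ^ 7 * (e + 2 * c * e) * ((n 0 k * n k ?i) * (n 0 k * n k ?j))"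
        using c e0 n0 by (intro mult_left_mono mult_mono nmul) (auto simp: less_imp_le)
      finally have r: "n ?i ?j / (n k ?i * n k ?j) \<le> real N ^ 7 * (e + 2 * c * e) * (n 0 k)\<^sup>2"
        using n0 by (simp add: divide_le_eq power2_eq_square mult_ac)
      have "cmod (T k ?i ?j a b) \<le> \<eta>" if "a < N" "b < N" for a b
      proof -
        have "cmod (T k ?i ?j a b) \<le> (real N)\<^sup>2 * (n ?i ?j / (n k ?i * n k ?j))"
          unfolding T_def R_def n_def pair[of k ?i ?j, symmetric]
          by (rule pairing_range_proj_le) (use n0 n_def that in auto)
        also have "\<dots> \<le> (real N)\<^sup>2 * (real N ^ 7 * (e + 2 * c * e) * (n 0 k)\<^sup>2)"
          by (intro mult_left_mono r) auto
        also have "\<dots> = (real N ^ 9 * (n 0 k)\<^sup>2 * (1 + 2 * c)) * e"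
          by (simp add: algebra_simps power_numeral_reduce)
        also have "\<dots> \<le> Q * e" using e0 unfolding Q_def by (intro mult_right_mono) auto
        also have "\<dots> = \<eta>" unfolding e_def using Q0 by simp
        finally show ?thesis .
      qed
      then show ?case by blast
    qed
  qed
  have T_bound: "cmod (T k (k - int l) (k + int l) a b) \<le> 2 * real N ^ 3 * E * q ^ l" if ab: "a < N" "b < N" for k l a b
  proof (rule field_le_epsilon)
    fix \<eta> :: real assume "\<eta> > 0"
    \<comment> \<open>For such \<open>M\<close> both ends -M and M lie at distance at least
      \<open>l\<close> from \<open>k\<close>, on either side of it, so the tail estimates based at
      \<open>k\<close> reach them.\<close>
    from eventually_conj[OF T_small[OF this, of k] eventually_ge_at_top[of "l + nat \<bar>k\<bar>"]]
    obtain M where M: "l + nat \<bar>k\<bar> \<le> M" "cmod (T k (- int M) (int M) a b) \<le> \<eta>"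
      using ab eventually_happens'[OF sequentially_bot] by (metis (mono_tags, lifting))
    have sub: "l \<le> nat (int M - k)" "l \<le> nat (int M + k)" using M(1) by linarith+
    have eq: "k + int (nat (int M - k)) = int M" "k - int (nat (int M + k)) = - int M"
      using M(1) by linarith+
    have "cmod (T k (- int M) (int M) a b - T k (k - int l) (k + int l) a b) \<le> 2 * (real N)\<^sup>2 * real N * (E * q ^ l)"
      unfolding T_def
      by (rule pairing_close[OF J ab]) (use tailp[OF sub(1), of _ _ k] tailm[OF sub(2), of _ _ k] RB eq in auto)
    then have 1: "cmod (T k (- int M) (int M) a b - T k (k - int l) (k + int l) a b) \<le> 2 * real N ^ 3 * E * q ^ l"
      by (simp add: power_numeral_reduce mult_ac)
    have "cmod (T k (k - int l) (k + int l) a b) \<le> cmod (T k (- int M) (int M) a b)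
        + cmod (T k (- int M) (int M) a b - T k (k - int l) (k + int l) a b)"
      by (metis norm_minus_commute norm_triangle_sub)
    then show "cmod (T k (k - int l) (k + int l) a b) \<le> 2 * real N ^ 3 * E * q ^ l + \<eta>" using 1 M(2) by linarith
  qed
  \<comment> \<open>The summand 1 makes \<open>ln C\<close> nonnegative, as
    \<open>doubling_contradiction\<close> demands of its \<open>A\<close>.\<close>
  define C where "C = real N ^ 7 * (2 * real N ^ 3 * E + 2 * c) + 1"
  have C1: "1 \<le> C" unfolding C_def using E0 c by simp
  have loss: "n (k - int l) (k + int l) \<le> C * q ^ l * (n k (k - int l) * n k (k + int l))" for k l
  proof -
    let ?i = "k - int l" and ?j = "k + int l"
    have "fro N (pairing N J (h k ?i) (h k ?j)) \<le> real N ^ 7 * (2 * real N ^ 3 * E * q ^ l + c * q ^ nat \<bar>k - ?i\<bar> + c * q ^ nat \<bar>k - ?j\<bar>)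
        * (fro N (h k ?i) * fro N (h k ?j))"
      using T_bound[of _ _ k l] c q E0 n0 unfolding T_def R_def n_def
      by (intro fro_pairing_le[OF J minor minor]) auto
    then have "n ?i ?j \<le> (real N ^ 7 * (2 * real N ^ 3 * E + 2 * c)) * q ^ l * (n k ?i * n k ?j)"
      unfolding pair n_def[symmetric] by (simp add: algebra_simps)
    also have "\<dots> \<le> C * q ^ l * (n k ?i * n k ?j)"
      using n0[of k ?i] n0[of k ?j] q unfolding C_def by (intro mult_right_mono) auto
    finally show ?thesis .
  qed
  show False
  proof (rule doubling_contradiction[of "\<lambda>i j. ln (n i j)" "ln K" "- ln q" "ln C"])
    show "ln (n (k - int l) (k + int l)) \<le> ln C - - ln q * real l + ln (n k (k - int l)) + ln (n k (k + int l))" for k l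
    proof -
      have "ln (n (k - int l) (k + int l)) \<le> ln (C * q ^ l * (n k (k - int l) * n k (k + int l)))"
        using loss[of k l] n0 by (intro ln_mono) (auto simp: less_imp_le)
      also have "\<dots> = ln C + real l * ln q + (ln (n k (k - int l)) + ln (n k (k + int l)))"
        using C1 q n0[of k] by (simp add: ln_mult_pos ln_realpow)
      finally show ?thesis by (simp add: mult_ac)
    qed
    show "ln (n i (i + 1)) \<le> ln K" for i
      using K[of i "i + 1"] n0[of i "i+1"] by (intro ln_mono) auto
  qed (use n1 nsym q C1 in auto)
qed

section \<open>Singular values\<close>

definition entries :: "complex mat \<Rightarrow> nat \<Rightarrow> nat \<Rightarrow> complex" where
  "entries A i j = A $$ (i, j)"

lemma mult_mat_index:
  fixes X Y :: "complex mat"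
  assumes "X \<in> carrier_mat N N" "Y \<in> carrier_mat N N" "i < N" "j < N"
  shows "(X * Y) $$ (i, j) = (\<Sum>k<N. X $$ (i, k) * Y $$ (k, j))"
  using assms by (simp add: scalar_prod_def lessThan_atLeast0)

lemma sum_diag_mult_comm:
  fixes X Y :: "complex mat"
  assumes "X \<in> carrier_mat N N" "Y \<in> carrier_mat N N"
  shows "(\<Sum>i<N. (X * Y) $$ (i, i)) = (\<Sum>i<N. (Y * X) $$ (i, i))"
proof -
  have "(\<Sum>i<N. (X * Y) $$ (i, i)) = (\<Sum>i<N. \<Sum>k<N. X $$ (i, k) * Y $$ (k, i))"
    using assms by (simp add: scalar_prod_def lessThan_atLeast0)
  also have "\<dots> = (\<Sum>k<N. \<Sum>i<N. Y $$ (k, i) * X $$ (i, k))"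
    by (subst sum.swap) (simp add: mult.commute)
  also have "\<dots> = (\<Sum>i<N. (Y * X) $$ (i, i))"
    using assms by (simp add: scalar_prod_def lessThan_atLeast0)
  finally show ?thesis .
qed

lemma sum_diag_similar:
  fixes M :: "complex mat"
  assumes "similar_mat_wit M B P Q" "M \<in> carrier_mat N N"
  shows "(\<Sum>i<N. M $$ (i, i)) = (\<Sum>i<N. B $$ (i, i))"
proof -
  from assms have c: "B \<in> carrier_mat N N" "P \<in> carrier_mat N N" "Q \<in> carrier_mat N N"
    and QP: "Q * P = 1\<^sub>m N" and M: "M = P * B * Q"
    unfolding similar_mat_wit_def Let_def by auto
  have "(\<Sum>i<N. M $$ (i, i)) = (\<Sum>i<N. (Q * (P * B)) $$ (i, i))"
    unfolding M using c by (intro sum_diag_mult_comm) auto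
  also have "Q * (P * B) = B" using c QP by (simp flip: assoc_mult_mat)
  finally show ?thesis .
qed

text \<open>Schur triangularisation: the diagonal sum is invariant under similarity, and squaring a
  triangular matrix squares its diagonal entries. These two power sums are what the estimate of the
  minors is built on.\<close>

lemma trace_eigenvalues:
  fixes M :: "complex mat"
  assumes M: "M \<in> carrier_mat N N" and es: "char_poly M = (\<Prod>e\<leftarrow>es. [:- e, 1:])"
  shows "length es = N" "(\<Sum>i<N. M $$ (i, i)) = (\<Sum>i<N. es ! i)"
    "(\<Sum>i<N. (M * M) $$ (i, i)) = (\<Sum>i<N. (es ! i)\<^sup>2)"
proof -
  obtain B P Q where BPQ: "schur_decomposition M es = (B, P, Q)" by (metis prod_cases3)
  note S = schur_decomposition[OF M es BPQ]
  then have sim: "similar_mat_wit M B P Q" and ut: "upper_triangular B" and diag: "diag_mat B = es" by auto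
  from sim M have c: "B \<in> carrier_mat N N" unfolding similar_mat_wit_def Let_def by auto
  show len: "length es = N" using diag c by (auto simp: diag_mat_def)
  have nth: "es ! i = B $$ (i, i)" if "i < N" for i
    using diag c that by (auto simp: diag_mat_def)
  show "(\<Sum>i<N. M $$ (i, i)) = (\<Sum>i<N. es ! i)"
    unfolding sum_diag_similar[OF sim M] using nth by simp
  have "similar_mat_wit (M ^\<^sub>m 2) (B ^\<^sub>m 2) P Q" by (rule similar_mat_wit_pow[OF sim])
  moreover have "M ^\<^sub>m 2 = M * M" "B ^\<^sub>m 2 = B * B" using M c by (simp_all add: numeral_2_eq_2)
  ultimately have sim2: "similar_mat_wit (M * M) (B * B) P Q" by simp
  have "(B * B) $$ (i, i) = (B $$ (i, i))\<^sup>2" if i: "i < N" for i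
  proof -
    have "(B * B) $$ (i, i) = (\<Sum>k<N. B $$ (i, k) * B $$ (k, i))"
      using c i by (simp add: scalar_prod_def lessThan_atLeast0)
    also have "\<dots> = (\<Sum>k<N. if k = i then (B $$ (i, i))\<^sup>2 else 0)"
    proof (rule sum.cong[OF refl])
      fix k assume "k \<in> {..<N}"
      then show "B $$ (i, k) * B $$ (k, i) = (if k = i then (B $$ (i, i))\<^sup>2 else 0)"
        using ut c i by (cases k i rule: linorder_cases) (auto simp: power2_eq_square upper_triangular_def)
    qed
    also have "\<dots> = (B $$ (i, i))\<^sup>2" using i by simp
    finally show ?thesis .
  qed
  then have "(\<Sum>i<N. (B * B) $$ (i, i)) = (\<Sum>i<N. (es ! i)\<^sup>2)" using nth by simp
  moreover have "M * M \<in> carrier_mat N N" using M by simp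
  ultimately show "(\<Sum>i<N. (M * M) $$ (i, i)) = (\<Sum>i<N. (es ! i)\<^sup>2)"
    using sum_diag_similar[OF sim2] by simp
qed

lemma mat_adjoint_carrier: "A \<in> carrier_mat N N \<Longrightarrow> mat_adjoint A \<in> carrier_mat N N"
  by (simp add: mat_adjoint_def mat_of_rows_def)

lemma mat_adjoint_index:
  "A \<in> carrier_mat N N \<Longrightarrow> i < N \<Longrightarrow> j < N \<Longrightarrow> mat_adjoint A $$ (i, j) = cnj (A $$ (j, i))"
  by (auto simp: mat_adjoint_def mat_of_rows_def)

lemma gram_index:
  assumes "A \<in> carrier_mat N N" "i < N" "j < N"
  shows "(mat_adjoint A * A) $$ (i, j) = (\<Sum>k<N. cnj (A $$ (k, i)) * A $$ (k, j))"
proof -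
  have "(mat_adjoint A * A) $$ (i, j) = (\<Sum>k<N. mat_adjoint A $$ (i, k) * A $$ (k, j))"
    using assms mat_adjoint_carrier[OF assms(1)] by (simp add: scalar_prod_def lessThan_atLeast0)
  also have "\<dots> = (\<Sum>k<N. cnj (A $$ (k, i)) * A $$ (k, j))"
    using assms by (intro sum.cong) (auto simp: mat_adjoint_index)
  finally show ?thesis .
qed

text \<open>An eigenvector v satisfies z |v|^2 = |A v|^2.\<close>

lemma gram_eigenvalue_nonneg:
  assumes A: "A \<in> carrier_mat N N" and ev: "eigenvalue (mat_adjoint A * A) z"
  shows "Im z = 0" "0 \<le> Re z"
proof -
  let ?M = "mat_adjoint A * A"
  have Mc: "?M \<in> carrier_mat N N" by (rule mult_carrier_mat[OF mat_adjoint_carrier[OF A] A])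
  from ev obtain v where v: "v \<in> carrier_vec N" "v \<noteq> 0\<^sub>v N" and Mv: "?M *\<^sub>v v = z \<cdot>\<^sub>v v"
    unfolding eigenvalue_def eigenvector_def using Mc by auto
  have row: "z * v $ i = (\<Sum>j<N. (\<Sum>k<N. cnj (A $$ (k, i)) * A $$ (k, j)) * v $ j)" if i: "i < N" for i
  proof -
    have "z * v $ i = (?M *\<^sub>v v) $ i" using Mv v i by simp
    also have "\<dots> = (\<Sum>j<N. ?M $$ (i, j) * v $ j)"
      using Mc v i by (simp add: scalar_prod_def lessThan_atLeast0 del: index_mult_mat)
    also have "\<dots> = (\<Sum>j<N. (\<Sum>k<N. cnj (A $$ (k, i)) * A $$ (k, j)) * v $ j)"
      using gram_index[OF A i] by (intro sum.cong) auto
    finally show ?thesis .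
  qed
  define w where "w k = (\<Sum>j<N. A $$ (k, j) * v $ j)" for k
  have "z * of_real (\<Sum>i<N. (cmod (v $ i))\<^sup>2) = (\<Sum>i<N. cnj (v $ i) * (z * v $ i))"
    unfolding of_real_sum complex_norm_square sum_distrib_left by (simp add: mult_ac)
  also have "\<dots> = (\<Sum>i<N. \<Sum>j<N. \<Sum>k<N. cnj (v $ i) * (cnj (A $$ (k, i)) * A $$ (k, j) * v $ j))"
    using row by (simp add: sum_distrib_left sum_distrib_right)
  also have "\<dots> = (\<Sum>i<N. \<Sum>k<N. \<Sum>j<N. cnj (v $ i) * (cnj (A $$ (k, i)) * A $$ (k, j) * v $ j))"
    by (rule sum.cong[OF refl], rule sum.swap)
  also have "\<dots> = (\<Sum>k<N. \<Sum>i<N. \<Sum>j<N. cnj (v $ i) * (cnj (A $$ (k, i)) * A $$ (k, j) * v $ j))"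
    by (rule sum.swap)
  also have "\<dots> = (\<Sum>k<N. cnj (w k) * w k)"
    unfolding w_def cnj_sum sum_product by (intro sum.cong refl) simp
  also have "\<dots> = of_real (\<Sum>k<N. (cmod (w k))\<^sup>2)"
    unfolding of_real_sum complex_norm_square by (simp add: mult.commute)
  finally have eq: "z * of_real (\<Sum>i<N. (cmod (v $ i))\<^sup>2) = of_real (\<Sum>k<N. (cmod (w k))\<^sup>2)" .
  define s where "s = (\<Sum>i<N. (cmod (v $ i))\<^sup>2)"
  have "\<exists>i<N. v $ i \<noteq> 0" using v by (metis carrier_vecD eq_vecI index_zero_vec(1) index_zero_vec(2))
  then have s: "0 < s" unfolding s_def by (force intro: sum_pos2)
  have "z = of_real ((\<Sum>k<N. (cmod (w k))\<^sup>2) / s)"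
    using eq s unfolding s_def[symmetric] by (simp add: field_simps)
  moreover have "0 \<le> (\<Sum>k<N. (cmod (w k))\<^sup>2) / s" using s by (intro divide_nonneg_pos sum_nonneg) auto
  ultimately show "Im z = 0" "0 \<le> Re z" by simp_all
qed

lemma singular_values_facts:
  assumes A: "A \<in> carrier_mat N N"
  shows "length (singular_values A) = N" "\<And>i. i < N \<Longrightarrow> 0 \<le> singular_values A ! i"
    "\<And>i j. i \<le> j \<Longrightarrow> j < N \<Longrightarrow> singular_values A ! j \<le> singular_values A ! i"
    "(\<Sum>i<N. (mat_adjoint A * A) $$ (i, i)) = of_real (\<Sum>i<N. (singular_values A ! i)\<^sup>2)"
    "(\<Sum>i<N. (mat_adjoint A * A * (mat_adjoint A * A)) $$ (i, i)) = of_real (\<Sum>i<N. (singular_values A ! i) ^ 4)"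
proof -
  let ?M = "mat_adjoint A * A"
  have Mc: "?M \<in> carrier_mat N N" by (rule mult_carrier_mat[OF mat_adjoint_carrier[OF A] A])
  let ?p = "char_poly ?M"
  have p0: "?p \<noteq> 0" and lead: "lead_coeff ?p = 1"
    using degree_monic_char_poly[OF Mc] by auto
  obtain es where es: "mset es = proots ?p" using ex_mset by blast
  have "?p = (\<Prod>x\<in>#proots ?p. [:- x, 1:])"
    using complex_poly_decompose_multiset[of ?p] lead by simp
  then have cp: "?p = (\<Prod>e\<leftarrow>es. [:- e, 1:])"
    unfolding es[symmetric] by (metis mset_map prod_mset_prod_list)
  note tr = trace_eigenvalues[OF Mc cp]
  have ev: "Im z = 0 \<and> 0 \<le> Re z" if "z \<in> set es" for z
  proof -
    have "z \<in># proots ?p" using that es by (metis set_mset_mset)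
    then have "poly ?p z = 0" using p0 by simp
    then have "eigenvalue ?M z" using eigenvalue_root_char_poly[OF Mc] by simp
    then show ?thesis using gram_eigenvalue_nonneg[OF A] by blast
  qed
  define ls where "ls = map (\<lambda>z. sqrt (Re z)) es"
  define sv where "sv = singular_values A"
  have svm: "mset sv = mset ls"
    unfolding sv_def singular_values_def es[symmetric] ls_def by simp
  have sorted: "sorted (rev sv)"
    unfolding sv_def singular_values_def by simp
  show len: "length (singular_values A) = N"
    using mset_eq_length[OF svm] tr(1) unfolding ls_def sv_def by simp
  have nn: "0 \<le> x" if "x \<in> set sv" for x
  proof -
    have "x \<in> set ls" using that svm by (metis set_mset_mset)
    then show ?thesis using ev unfolding ls_def by auto
  qed
  then show "0 \<le> singular_values A ! i" if "i < N" for i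
    using that len unfolding sv_def by auto
  show "singular_values A ! j \<le> singular_values A ! i" if "i \<le> j" "j < N" for i j
    using sorted_rev_nth_mono[OF sorted that(1)] that len unfolding sv_def by simp
  \<comment> \<open>Sorting only permutes the list, so symmetric sums are what can be transferred
    from the eigenvalues to the singular values.\<close>
  have sums: "(\<Sum>i<N. f (sv ! i)) = (\<Sum>i<N. f (ls ! i))" for f :: "real \<Rightarrow> real"
  proof -
    have "(\<Sum>i<length xs. f (xs ! i)) = sum_mset (mset (map f xs))" for xs
      unfolding sum_mset_sum_list by (simp add: sum_list_sum_nth lessThan_atLeast0)
    from this[of sv] this[of ls] show ?thesis
      using svm mset_eq_length[OF svm] len unfolding sv_def by simp
  qed
  have lsnth: "of_real ((ls ! i)\<^sup>2) = es ! i" if "i < N" for i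
    using ev[of "es ! i"] that tr(1) unfolding ls_def by (simp add: complex_eq_iff)
  have lsnth4: "of_real ((ls ! i) ^ 4) = (es ! i)\<^sup>2" if "i < N" for i
    unfolding lsnth[OF that, symmetric] by (simp flip: power_mult)
  show "(\<Sum>i<N. ?M $$ (i, i)) = of_real (\<Sum>i<N. (singular_values A ! i)\<^sup>2)"
    unfolding tr(2) sv_def[symmetric] sums[of "\<lambda>x. x\<^sup>2"] of_real_sum
    by (rule sum.cong[OF refl]) (metis lsnth lessThan_iff)
  show "(\<Sum>i<N. (?M * ?M) $$ (i, i)) = of_real (\<Sum>i<N. (singular_values A ! i) ^ 4)"
    unfolding tr(3) sv_def[symmetric] sums[of "\<lambda>x. x ^ 4"] of_real_sum
    by (rule sum.cong[OF refl]) (metis lsnth4 lessThan_iff)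
qed

lemma fro_singular_values:
  assumes A: "A \<in> carrier_mat N N"
  shows "(fro N (entries A))\<^sup>2 = (\<Sum>i<N. (singular_values A ! i)\<^sup>2)"
proof -
  have "of_real ((fro N (entries A))\<^sup>2) = (\<Sum>i<N. \<Sum>k<N. cnj (A $$ (k, i)) * A $$ (k, i))"
    unfolding fro_sq_complex entries_def by (subst sum.swap) (simp add: mult.commute)
  also have "\<dots> = (\<Sum>i<N. (mat_adjoint A * A) $$ (i, i))"
    using gram_index[OF A] by (intro sum.cong) auto
  also have "\<dots> = of_real (\<Sum>i<N. (singular_values A ! i)\<^sup>2)"
    by (rule singular_values_facts(4)[OF A])
  finally show ?thesis by (simp only: of_real_eq_iff)
qed

text \<open>By Cauchy-Binet the squared minors with i < k and j < l add up to the second elementary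
  symmetric function e_2 of the squared singular values. The free indices count each of them four
  times, and 2 e_2 is the difference of the power sums.\<close>

lemma sum_minors_squared:
  assumes A: "A \<in> carrier_mat N N"
  shows "(\<Sum>i<N. \<Sum>k<N. \<Sum>j<N. \<Sum>l<N. (cmod (A $$ (i, j) * A $$ (k, l) - A $$ (i, l) * A $$ (k, j)))\<^sup>2)
    = 2 * ((\<Sum>i<N. (singular_values A ! i)\<^sup>2)\<^sup>2 - (\<Sum>i<N. (singular_values A ! i) ^ 4))"
proof -
  let ?M = "mat_adjoint A * A" and ?a = "\<lambda>i j. A $$ (i, j)"
  let ?g = "\<lambda>j l. \<Sum>k<N. cnj (?a k j) * ?a k l"
  have Mc: "?M \<in> carrier_mat N N" by (rule mult_carrier_mat[OF mat_adjoint_carrier[OF A] A])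
  have t1: "(\<Sum>j<N. ?g j j) = of_real (\<Sum>i<N. (singular_values A ! i)\<^sup>2)"
    unfolding singular_values_facts(4)[OF A, symmetric] using gram_index[OF A] by (intro sum.cong) auto
  have t2: "(\<Sum>j<N. \<Sum>l<N. ?g j l * ?g l j) = of_real (\<Sum>i<N. (singular_values A ! i) ^ 4)"
  proof -
    have "(?M * ?M) $$ (j, j) = (\<Sum>l<N. ?M $$ (j, l) * ?M $$ (l, j))" if "j < N" for j
      by (rule mult_mat_index[OF Mc Mc that that])
    then have "(?M * ?M) $$ (j, j) = (\<Sum>l<N. ?g j l * ?g l j)" if "j < N" for j
      using that gram_index[OF A] by simp
    then show ?thesis unfolding singular_values_facts(5)[OF A, symmetric] by simp
  qed
  have "of_real (\<Sum>i<N. \<Sum>k<N. \<Sum>j<N. \<Sum>l<N. (cmod (?a i j * ?a k l - ?a i l * ?a k j))\<^sup>2)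
    = (\<Sum>i<N. \<Sum>k<N. \<Sum>j<N. \<Sum>l<N. (?a i j * ?a k l - ?a i l * ?a k j) * cnj (?a i j * ?a k l - ?a i l * ?a k j))"
    by (simp only: of_real_sum complex_norm_square)
  also have "\<dots> = (\<Sum>j<N. \<Sum>l<N. \<Sum>i<N. \<Sum>k<N. (?a i j * ?a k l - ?a i l * ?a k j) * cnj (?a i j * ?a k l - ?a i l * ?a k j))"
    by (rule sum_swap4)
  \<comment> \<open>After expansion the sums over \<open>i\<close> and \<open>k\<close> separate,
    which leaves products of two entries of the Gram matrix.\<close>
  also have "\<dots> = (\<Sum>j<N. \<Sum>l<N. ?g j j * ?g l l - ?g l j * ?g j l - ?g j l * ?g l j + ?g l l * ?g j j)"
    unfolding sum_product sum_subtractf[symmetric] sum.distrib[symmetric]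
    by (rule sum.cong[OF refl], rule sum.cong[OF refl], rule sum.cong[OF refl], rule sum.cong[OF refl])
      (simp add: algebra_simps)
  also have "\<dots> = (\<Sum>j<N. \<Sum>l<N. 2 * (?g j j * ?g l l) - 2 * (?g j l * ?g l j))"
    by (intro sum.cong refl) simp
  also have "\<dots> = 2 * ((\<Sum>j<N. ?g j j) * (\<Sum>l<N. ?g l l)) - 2 * (\<Sum>j<N. \<Sum>l<N. ?g j l * ?g l j)"
  proof -
    have "(\<Sum>j<N. \<Sum>l<N. 2 * (g j j * g l l) - 2 * (g j l * g l j))
        = 2 * ((\<Sum>j<N. g j j) * (\<Sum>l<N. g l l)) - 2 * (\<Sum>j<N. \<Sum>l<N. g j l * g l j)" for g :: "nat \<Rightarrow> nat \<Rightarrow> complex"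
    proof -
      have "(\<Sum>j<N. g j j) * (\<Sum>l<N. g l l) = (\<Sum>j<N. \<Sum>l<N. g j j * g l l)" by (rule sum_product)
      then show ?thesis by (simp only: sum_subtractf sum_distrib_left)
    qed
    then show ?thesis .
  qed
  also have "\<dots> = of_real (2 * ((\<Sum>i<N. (singular_values A ! i)\<^sup>2)\<^sup>2 - (\<Sum>i<N. (singular_values A ! i) ^ 4)))"
    unfolding t1 t2 by (simp add: power2_eq_square algebra_simps)
  finally show ?thesis by (simp only: of_real_eq_iff)
qed

text \<open>The sum of the squared minors is controlled by the product of the two largest singular
  values, hence so is every single minor. The gap trades the second singular value for the first one
  divided by \<open>t\<close>, and the first is at most the Frobenius norm.\<close>

lemma minor_bound_singular_values:
  assumes A: "A \<in> carrier_mat N N" and N: "2 \<le> N" and t: "0 < t"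
    and gap: "t \<le> singular_value 1 A / singular_value 2 A"
  shows "minor_bound N (entries A) (2 * real N / t)"
proof -
  let ?s = "\<lambda>i. singular_values A ! i"
  note F = singular_values_facts[OF A]
  have g: "t \<le> ?s 0 / ?s 1" using gap by (simp add: singular_value_def)
  \<comment> \<open>Division by zero yields 0, so a positive lower bound on the quotient forces the
    second singular value to be positive.\<close>
  have s1: "0 < ?s 1"
    using F(2)[of 1] N g t by (cases "?s 1 = 0") auto
  have s10: "?s 1 \<le> ?s 0 / t" using g s1 t by (simp add: field_simps)
  have s0: "0 < ?s 0" using F(3)[of 0 1] s1 N by simp
  have prod: "(?s i)\<^sup>2 * (?s j)\<^sup>2 \<le> (?s 0)\<^sup>2 * (?s 1)\<^sup>2" if "i < N" "j < N" "i \<noteq> j" for i j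
  proof -
    have *: "(?s i)\<^sup>2 * (?s j)\<^sup>2 \<le> (?s 0)\<^sup>2 * (?s 1)\<^sup>2" if "i < N" "j < N" "i < j" for i j
      using that by (intro mult_mono power_mono F(2,3)) auto
    show ?thesis using *[of i j] *[of j i] that by (cases "i < j") (auto simp: mult.commute)
  qed
  have "(\<Sum>i<N. (?s i)\<^sup>2)\<^sup>2 = (\<Sum>i<N. \<Sum>j<N. (?s i)\<^sup>2 * (?s j)\<^sup>2)"
    by (simp add: power2_eq_square sum_product)
  moreover have "(\<Sum>i<N. \<Sum>j<N. (?s i)\<^sup>2 * (?s j)\<^sup>2) \<le> (\<Sum>i<N. \<Sum>j<N. (if j = i then (?s i) ^ 4 else 0) + (?s 0)\<^sup>2 * (?s 1)\<^sup>2)"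
    using prod by (intro sum_mono) (auto simp: power2_eq_square power4_eq_xxxx)
  moreover have "(\<Sum>i<N. \<Sum>j<N. (if j = i then (?s i) ^ 4 else 0) + (?s 0)\<^sup>2 * (?s 1)\<^sup>2)
     = (\<Sum>i<N. (?s i) ^ 4) + (real N)\<^sup>2 * ((?s 0)\<^sup>2 * (?s 1)\<^sup>2)"
    by (simp add: sum.distrib power2_eq_square)
  ultimately have e2: "(\<Sum>i<N. (?s i)\<^sup>2)\<^sup>2 - (\<Sum>i<N. (?s i) ^ 4) \<le> (real N)\<^sup>2 * ((?s 0)\<^sup>2 * (?s 1)\<^sup>2)"
    by linarith
  have s0f: "(?s 0)\<^sup>2 \<le> (fro N (entries A))\<^sup>2"
    unfolding fro_singular_values[OF A] using N by (intro member_le_sum) auto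
  have "cmod (entries A i j * entries A k l - entries A i l * entries A k j) \<le> 2 * real N / t * (fro N (entries A))\<^sup>2"
    if ij: "i < N" "j < N" "k < N" "l < N" for i j k l
  proof -
    let ?f = "\<lambda>i k j l. (cmod (A $$ (i, j) * A $$ (k, l) - A $$ (i, l) * A $$ (k, j)))\<^sup>2"
    have "?f i k j l \<le> (\<Sum>l<N. ?f i k j l)"
      using ij by (intro member_le_sum[of l]) auto
    also have "\<dots> \<le> (\<Sum>j<N. \<Sum>l<N. ?f i k j l)"
      using ij by (intro member_le_sum[of j _ "\<lambda>j. \<Sum>l<N. ?f i k j l"]) (auto intro: sum_nonneg)
    also have "\<dots> \<le> (\<Sum>k<N. \<Sum>j<N. \<Sum>l<N. ?f i k j l)"
      using ij by (intro member_le_sum[of k _ "\<lambda>k. \<Sum>j<N. \<Sum>l<N. ?f i k j l"]) (auto intro!: sum_nonneg)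
    also have "\<dots> \<le> (\<Sum>i<N. \<Sum>k<N. \<Sum>j<N. \<Sum>l<N. ?f i k j l)"
      using ij by (intro member_le_sum[of i _ "\<lambda>i. \<Sum>k<N. \<Sum>j<N. \<Sum>l<N. ?f i k j l"]) (auto intro!: sum_nonneg)
    also have "\<dots> \<le> 2 * (real N * ?s 0 * ?s 1)\<^sup>2"
      unfolding sum_minors_squared[OF A] using e2 by (simp add: power_mult_distrib)
    also have "\<dots> \<le> (2 * (real N * ?s 0 * ?s 1))\<^sup>2" by (simp add: power_mult_distrib)
    finally have "cmod (A $$ (i, j) * A $$ (k, l) - A $$ (i, l) * A $$ (k, j)) \<le> 2 * (real N * ?s 0 * ?s 1)"
      by (rule power2_le_imp_le) (use s0 s1 in auto)
    also have "\<dots> \<le> 2 * (real N * ?s 0 * (?s 0 / t))"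
      using s10 s0 by (intro mult_left_mono) auto
    also have "\<dots> = 2 * real N / t * (?s 0)\<^sup>2" by (simp add: power2_eq_square)
    also have "\<dots> \<le> 2 * real N / t * (fro N (entries A))\<^sup>2"
      using t by (intro mult_left_mono s0f) auto
    finally show ?thesis unfolding entries_def .
  qed
  then show ?thesis unfolding minor_bound_def by blast
qed

section \<open>Word metrics and geodesic rays\<close>

lemma (in group) foldr_mult_closed:
  "set ws \<subseteq> carrier G \<Longrightarrow> foldr (\<otimes>) ws \<one> \<in> carrier G"
  by (induction ws) auto

lemma (in group) foldr_mult_append:
  "set xs \<subseteq> carrier G \<Longrightarrow> set ys \<subseteq> carrier G \<Longrightarrow>
    foldr (\<otimes>) (xs @ ys) \<one> = foldr (\<otimes>) xs \<one> \<otimes> foldr (\<otimes>) ys \<one>"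
  by (induction xs) (auto simp: m_assoc foldr_mult_closed)

lemma (in group) foldr_mult_rev_inv:
  "set xs \<subseteq> carrier G \<Longrightarrow> foldr (\<otimes>) (rev (map (m_inv G) xs)) \<one> = inv (foldr (\<otimes>) xs \<one>)"
proof (induction xs)
  case (Cons x xs)
  have "set (rev (map (m_inv G) xs)) \<subseteq> carrier G" using Cons.prems by auto
  then have "foldr (\<otimes>) (rev (map (m_inv G) (x # xs))) \<one> = inv (foldr (\<otimes>) xs \<one>) \<otimes> inv x"
    using Cons by (simp add: foldr_mult_append del: foldr_append)
  then show ?case using Cons.prems by (simp add: inv_mult_group foldr_mult_closed)
qed simp

locale fin_gen_group = group G for G :: "('a, 'b) monoid_scheme" (structure) +
  fixes S :: "'a set"
  assumes fg: "finite_generating_set G S"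
begin

abbreviation letters :: "'a set" where "letters \<equiv> S \<union> m_inv G ` S"

lemma letters_carrier: "letters \<subseteq> carrier G"
  using fg by (auto simp: finite_generating_set_def)

lemma finite_letters: "finite letters"
  using fg by (auto simp: finite_generating_set_def)

lemma inv_letters: "x \<in> letters \<Longrightarrow> inv x \<in> letters"
  using letters_carrier by auto

lemma ex_word:
  assumes "g \<in> carrier G"
  shows "\<exists>ws. set ws \<subseteq> letters \<and> foldr (\<otimes>) ws \<one> = g"
proof -
  from assms have "g \<in> generate G S" using fg by (simp add: finite_generating_set_def)
  then show ?thesis
  proof (induction rule: generate.induct)
    case one show ?case by (rule exI[of _ "[]"]) simp
  next
    case (incl h)
    then show ?case using letters_carrier by (intro exI[of _ "[h]"]) auto
  next
    case (inv h)
    then show ?case using letters_carrier by (intro exI[of _ "[m_inv G h]"]) auto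
  next
    case (eng h1 h2)
    then obtain xs ys where *: "set xs \<subseteq> letters" "foldr (\<otimes>) xs \<one> = h1" "set ys \<subseteq> letters" "foldr (\<otimes>) ys \<one> = h2"
      by blast
    then have "foldr (\<otimes>) (xs @ ys) \<one> = h1 \<otimes> h2"
      using letters_carrier foldr_mult_append[of xs ys] by (metis order_trans)
    then show ?case using * by (intro exI[of _ "xs @ ys"]) auto
  qed
qed

lemma word_length_le:
  "set ws \<subseteq> letters \<Longrightarrow> foldr (\<otimes>) ws \<one> = g \<Longrightarrow> word_length G S g \<le> length ws"
  unfolding word_length_def by (rule Least_le) blast

lemma ex_shortest_word:
  assumes "g \<in> carrier G"
  obtains ws where "length ws = word_length G S g" "set ws \<subseteq> letters" "foldr (\<otimes>) ws \<one> = g"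
proof -
  have "\<exists>n ws. length ws = n \<and> set ws \<subseteq> letters \<and> foldr (\<otimes>) ws \<one> = g"
    using ex_word[OF assms] by blast
  from LeastI_ex[OF this] show ?thesis using that unfolding word_length_def by blast
qed

lemma word_length_mult:
  assumes "g \<in> carrier G" "h \<in> carrier G"
  shows "word_length G S (g \<otimes> h) \<le> word_length G S g + word_length G S h"
proof -
  obtain xs where xs: "length xs = word_length G S g" "set xs \<subseteq> letters" "foldr (\<otimes>) xs \<one> = g"
    using ex_shortest_word[OF assms(1)] .
  obtain ys where ys: "length ys = word_length G S h" "set ys \<subseteq> letters" "foldr (\<otimes>) ys \<one> = h"
    using ex_shortest_word[OF assms(2)] .
  have "foldr (\<otimes>) (xs @ ys) \<one> = g \<otimes> h"
    using xs ys letters_carrier foldr_mult_append[of xs ys] by (metis order_trans)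
  then show ?thesis using word_length_le[of "xs @ ys"] xs ys by auto
qed

lemma word_length_inv_le:
  assumes "g \<in> carrier G" shows "word_length G S (inv g) \<le> word_length G S g"
proof -
  obtain xs where xs: "length xs = word_length G S g" "set xs \<subseteq> letters" "foldr (\<otimes>) xs \<one> = g"
    using ex_shortest_word[OF assms] .
  have "foldr (\<otimes>) (rev (map (m_inv G) xs)) \<one> = inv g"
    using xs letters_carrier foldr_mult_rev_inv[of xs] by (metis order_trans)
  moreover have "set (rev (map (m_inv G) xs)) \<subseteq> letters"
    using xs(2) inv_letters by auto
  ultimately show ?thesis using word_length_le[of "rev (map (m_inv G) xs)"] xs(1) by auto
qed

lemma word_length_inv: "g \<in> carrier G \<Longrightarrow> word_length G S (inv g) = word_length G S g"
  using word_length_inv_le[of g] word_length_inv_le[of "inv g"] by simp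

lemma word_dist_sym:
  assumes "g \<in> carrier G" "h \<in> carrier G" shows "word_dist G S g h = word_dist G S h g"
proof -
  have "inv (inv g \<otimes> h) = inv h \<otimes> g" using assms by (simp add: inv_mult_group)
  then show ?thesis unfolding word_dist_def using word_length_inv[of "inv g \<otimes> h"] assms by simp
qed

lemma word_dist_triangle:
  assumes "g \<in> carrier G" "h \<in> carrier G" "k \<in> carrier G"
  shows "word_dist G S g k \<le> word_dist G S g h + word_dist G S h k"
proof -
  have "inv g \<otimes> k = (inv g \<otimes> h) \<otimes> (inv h \<otimes> k)"
  proof -
    have "h \<otimes> (inv h \<otimes> k) = k" using assms by (simp flip: m_assoc)
    then show ?thesis using assms by (simp add: m_assoc)
  qed
  then show ?thesis unfolding word_dist_def
    using word_length_mult[of "inv g \<otimes> h" "inv h \<otimes> k"] assms by (metis inv_closed m_closed of_nat_add of_nat_le_iff)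
qed

lemma submultiplicative_le_word_length:
  fixes \<phi> :: "'a \<Rightarrow> real"
  assumes nonneg: "\<And>g. 0 \<le> \<phi> g"
    and sub: "\<And>g h. g \<in> carrier G \<Longrightarrow> h \<in> carrier G \<Longrightarrow> \<phi> (g \<otimes> h) \<le> \<phi> g * \<phi> h"
  obtains K where "1 \<le> K" "\<And>g. g \<in> carrier G \<Longrightarrow> \<phi> g \<le> \<phi> \<one> * K ^ word_length G S g"
proof
  \<comment> \<open>A sum over the letters bounds each of them and, unlike a maximum, also makes
    sense when there are none.\<close>
  define K where "K = 1 + sum \<phi> letters"
  show K1: "1 \<le> K" unfolding K_def using nonneg by (simp add: sum_nonneg)
  have letter: "\<phi> x \<le> K" if "x \<in> letters" for x
    using member_le_sum[OF that _ finite_letters, of \<phi>] nonneg unfolding K_def by fastforce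
  have word: "\<phi> (foldr (\<otimes>) ws \<one>) \<le> \<phi> \<one> * K ^ length ws" if "set ws \<subseteq> letters" for ws
    using that
  proof (induction ws)
    case (Cons x ws)
    then have c: "x \<in> carrier G" "foldr (\<otimes>) ws \<one> \<in> carrier G"
      using letters_carrier by (auto intro!: foldr_mult_closed)
    have "\<phi> (x \<otimes> foldr (\<otimes>) ws \<one>) \<le> \<phi> x * \<phi> (foldr (\<otimes>) ws \<one>)"
      using c by (rule sub)
    also have "\<dots> \<le> K * (\<phi> \<one> * K ^ length ws)"
      using Cons letter[of x] K1 nonneg by (intro mult_mono) auto
    finally show ?case by (simp add: mult_ac)
  qed simp
  show "\<phi> g \<le> \<phi> \<one> * K ^ word_length G S g" if "g \<in> carrier G" for g
    using ex_shortest_word[OF that] word by metis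
qed

section \<open>Geodesic rays and their divergence\<close>

lemma ray_carrier: "r \<in> geodesic_rays G S \<Longrightarrow> r n \<in> carrier G"
  by (simp add: geodesic_rays_def)

lemma ray_0: "r \<in> geodesic_rays G S \<Longrightarrow> r 0 = \<one>"
  by (simp add: geodesic_rays_def)

lemma ray_dist: "r \<in> geodesic_rays G S \<Longrightarrow> word_dist G S (r i) (r j) = \<bar>real i - real j\<bar>"
  by (simp add: geodesic_rays_def)

lemma ray_length:
  assumes "r \<in> geodesic_rays G S" shows "word_length G S (r n) = n"
proof -
  have "word_dist G S (r 0) (r n) = real n" using ray_dist[OF assms] by simp
  then show ?thesis using ray_0[OF assms] ray_carrier[OF assms] by (simp add: word_dist_def)
qed

lemma equiv_asymptotic_rel: "equiv (geodesic_rays G S) (asymptotic_rel G S)"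
proof (rule equivI)
  show "asymptotic_rel G S \<subseteq> geodesic_rays G S \<times> geodesic_rays G S"
    by (auto simp: asymptotic_rel_def)
  show "refl_on (geodesic_rays G S) (asymptotic_rel G S)"
    by (auto simp: refl_on_def asymptotic_rel_def ray_dist)
  show "sym (asymptotic_rel G S)"
    unfolding sym_def asymptotic_rel_def by (auto simp: word_dist_sym[OF ray_carrier ray_carrier])
  show "trans (asymptotic_rel G S)"
  proof (rule transI)
    fix r s t assume "(r, s) \<in> asymptotic_rel G S" "(s, t) \<in> asymptotic_rel G S"
    then obtain C D where rs: "r \<in> geodesic_rays G S" "s \<in> geodesic_rays G S" "t \<in> geodesic_rays G S"
      and "\<And>n. word_dist G S (r n) (s n) \<le> C" "\<And>n. word_dist G S (s n) (t n) \<le> D"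
      unfolding asymptotic_rel_def by blast
    then have "word_dist G S (r n) (t n) \<le> C + D" for n
      using word_dist_triangle[of "r n" "s n" "t n"] ray_carrier by (meson add_mono order_trans)
    then show "(r, t) \<in> asymptotic_rel G S" using rs unfolding asymptotic_rel_def by blast
  qed
qed

text \<open>If the Gromov products (r n | s m) were unbounded, two uses of the four-point inequality
  would give (r k | s k) >= k - 2 \<delta>, keeping the rays within 4 \<delta> of each other. So
  they are bounded, and \<open>C\<close> is twice the bound. Consequently the two rays glued at the
  identity form a quasi-geodesic.\<close>

lemma nonasymptotic_rays_diverge:
  assumes hyp: "gromov_hyperbolic (carrier G) (word_dist G S)"
    and r: "r \<in> geodesic_rays G S" and s: "s \<in> geodesic_rays G S"
    and ne: "(r, s) \<notin> asymptotic_rel G S"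
  obtains C where "\<And>n m. word_dist G S (r n) (s m) \<ge> real n + real m - C"
proof -
  let ?d = "word_dist G S" and ?P = "gromov_product (word_dist G S) \<one>"
  obtain \<delta> where \<delta>: "\<And>x y z. x \<in> carrier G \<Longrightarrow> y \<in> carrier G \<Longrightarrow> z \<in> carrier G \<Longrightarrow>
      ?P x z \<ge> min (?P x y) (?P y z) - \<delta>"
    using hyp one_closed unfolding gromov_hyperbolic_def by blast
  have d1: "?d (r n) \<one> = real n" "?d (s n) \<one> = real n" for n
    using ray_dist[OF r, of n 0] ray_dist[OF s, of n 0] ray_0[OF r] ray_0[OF s] by auto
  have pr: "?P (r k) (r n) = min (real k) (real n)" "?P (s k) (s n) = min (real k) (real n)" for k n
    unfolding gromov_product_def d1 ray_dist[OF r] ray_dist[OF s] by (auto simp: min_def)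
  have "\<exists>K. \<forall>n m. ?P (r n) (s m) \<le> real K"
  proof (rule ccontr)
    assume "\<nexists>K. \<forall>n m. ?P (r n) (s m) \<le> real K"
    then have big: "\<exists>n m. ?P (r n) (s m) > real K" for K by (meson not_le)
    have "?d (r k) (s k) \<le> 4 * \<delta>" for k
    proof -
      obtain n m where nm: "?P (r n) (s m) > real k" using big by blast
      \<comment> \<open>A Gromov product is at most the distance of either point from the base, so
        \<open>n\<close> and \<open>m\<close> both exceed \<open>k\<close>.\<close>
      have tri: "?d (r n) \<one> \<le> ?d (r n) (s m) + ?d (s m) \<one>" "?d (s m) \<one> \<le> ?d (s m) (r n) + ?d (r n) \<one>"
        using ray_carrier[OF r] ray_carrier[OF s] by (auto intro!: word_dist_triangle)
      have "?d (s m) (r n) = ?d (r n) (s m)"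
        using ray_carrier[OF r] ray_carrier[OF s] by (auto intro: word_dist_sym)
      then have nk: "real k < real n" "real k < real m"
        using tri nm unfolding gromov_product_def d1 less_divide_eq_numeral1 by linarith+
      have 1: "?P (r n) (s k) \<ge> real k - \<delta>"
        using \<delta>[of "r n" "s m" "s k"] ray_carrier[OF r] ray_carrier[OF s] nm nk pr(2)[of m k] by fastforce
      have "\<delta> \<ge> 0" using \<delta>[of \<one> \<one> \<one>] by simp
      then have "?P (r k) (s k) \<ge> real k - 2 * \<delta>"
        using \<delta>[of "r k" "r n" "s k"] ray_carrier[OF r] ray_carrier[OF s] nk pr(1)[of k n] 1 by fastforce
      then have *: "real k - 2 * \<delta> \<le> (real k + real k - ?d (r k) (s k)) / 2"
        unfolding gromov_product_def d1 .
      have "a - 2 * b \<le> (a + a - c) / 2 \<Longrightarrow> c \<le> 4 * b" for a b c :: real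
        by simp
      from this[OF *] show ?thesis .
    qed
    then show False using ne r s unfolding asymptotic_rel_def by blast
  qed
  then obtain K where K: "\<And>n m. ?P (r n) (s m) \<le> real K" by blast
  have "?d (r n) (s m) \<ge> real n + real m - 2 * real K" for n m
    using K[of n m] unfolding gromov_product_def d1 divide_le_eq_numeral1 by linarith
  then show ?thesis using that by blast
qed

end

section \<open>Odd maps on the sphere\<close>

text \<open>If f = exp g, oddness makes g (-x) - g x a logarithm of -1. These logarithms form a
  discrete set, so the difference is constant on the connected sphere; being odd in x, it is 0,
  which is no logarithm of -1.\<close>

lemma odd_map_on_sphere_has_zero:
  fixes f :: "'a::euclidean_space \<Rightarrow> complex"
  assumes dim: "3 \<le> DIM('a)" and cont: "continuous_on (sphere 0 1) f"
    and odd: "\<And>x. x \<in> sphere 0 1 \<Longrightarrow> f (- x) = - f x"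
  shows "\<exists>x\<in>sphere 0 1. f x = 0"
proof (rule ccontr)
  assume nz: "\<not> (\<exists>x\<in>sphere 0 1. f x = 0)"
  let ?S = "sphere (0::'a) 1"
  obtain g where g: "continuous_on ?S g" "\<And>x. x \<in> ?S \<Longrightarrow> f x = exp (g x)"
    using Borsukian_sphere[OF dim, of 0 1] cont nz unfolding Borsukian_continuous_logarithm
    by (auto simp: Pi_iff)
  have neg: "- x \<in> ?S" if "x \<in> ?S" for x using that by simp
  define d where "d x = g (- x) - g x" for x
  have "continuous_on ?S (\<lambda>x. g (- x))"
    by (rule continuous_on_compose2[OF g(1)]) (auto intro!: continuous_intros)
  then have contd: "continuous_on ?S d" unfolding d_def using g(1) by (intro continuous_intros)
  have expd: "exp (d x) = -1" if "x \<in> ?S" for x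
  proof -
    have "exp (d x) = f (- x) / f x" unfolding d_def using g(2) that neg by (simp add: exp_diff)
    then show ?thesis using odd[OF that] nz that by auto
  qed
  have "d constant_on ?S"
  proof (rule continuous_discrete_range_constant[OF _ contd])
    show "connected ?S" using dim by (intro connected_sphere) auto
    fix x assume x: "x \<in> ?S"
    show "\<exists>e>0. \<forall>y. y \<in> ?S \<and> d y \<noteq> d x \<longrightarrow> e \<le> cmod (d y - d x)"
    proof (intro exI[of _ "2 * pi"] conjI allI impI)
      fix y assume y: "y \<in> ?S \<and> d y \<noteq> d x"
      then have "exp (d y) = exp (d x)" using expd x by simp
      then obtain n :: int where n: "d y = d x + (of_int (2 * n) * pi) * \<i>" unfolding exp_eq by blast
      then have "n \<noteq> 0" using y by auto
      then have "2 * pi * 1 \<le> 2 * pi * real_of_int \<bar>n\<bar>" by (intro mult_left_mono) auto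
      moreover have "cmod (d y - d x) = 2 * pi * real_of_int \<bar>n\<bar>"
        unfolding n by (simp add: norm_mult abs_mult)
      ultimately show "2 * pi \<le> cmod (d y - d x)" by simp
    qed simp
  qed
  then obtain c where c: "\<And>x. x \<in> ?S \<Longrightarrow> d x = c" unfolding constant_on_def by blast
  obtain x where x: "x \<in> ?S" using vector_choose_size[of 1] by auto
  have "d (- x) = - d x" by (simp add: d_def)
  then have "d x = 0" using c[OF x] c[OF neg[OF x]] by simp
  then show False using expd[OF x] by simp
qed

text \<open>\<open>nsphere 2\<close> consists of functions on the natural numbers, whereas
  \<open>complex \<times> real\<close> is a 3-dimensional Euclidean space, to whose unit sphere the
  previous lemma applies. These coordinates lead from the latter to the former.\<close>

definition sphere_coords :: "complex \<times> real \<Rightarrow> nat \<Rightarrow> real" where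
  "sphere_coords p i = (if i = 0 then Re (fst p) else if i = 1 then Im (fst p) else if i = 2 then snd p else 0)"

lemma continuous_map_sphere_coords:
  "continuous_map (top_of_set (sphere 0 1)) (nsphere 2) sphere_coords"
proof -
  have "continuous_on (sphere 0 1) (\<lambda>p. sphere_coords p i)" for i
    unfolding sphere_coords_def by (cases "i = 0"; cases "i = 1"; cases "i = 2") (auto intro!: continuous_intros)
  moreover have "(\<Sum>i\<le>2. (sphere_coords p i)\<^sup>2) = 1" if "p \<in> sphere 0 1" for p
  proof -
    have "(norm p)\<^sup>2 = 1" using that by simp
    moreover have "{..2::nat} = {0, 1, 2}" by auto
    ultimately show ?thesis
      by (cases p) (simp add: norm_Pair cmod_power2 sphere_coords_def)
  qed
  moreover have zero: "sphere_coords p i = 0" if "i > 2" for p i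
    using that by (simp add: sphere_coords_def)
  ultimately show ?thesis
    unfolding nsphere continuous_map_in_subtopology
    by (auto simp: continuous_map_componentwise_UNIV zero simp del: mem_sphere_0)
qed

lemma sphere_coords_neq: "p \<in> sphere 0 1 \<Longrightarrow> sphere_coords p \<noteq> sphere_coords (- p)"
proof
  assume p: "p \<in> sphere 0 1" and eq: "sphere_coords p = sphere_coords (- p)"
  from fun_cong[OF eq, of 0] fun_cong[OF eq, of 1] fun_cong[OF eq, of 2]
  have "p = 0" by (simp add: sphere_coords_def prod_eq_iff complex_eq_iff)
  then show False using p by simp
qed

text \<open>Alternation of F becomes oddness of F evaluated at the images of p and -p. Continuity of
  F is expressed through pairs of maps from the sphere into X, which keeps product topologies
  out.\<close>

lemma alternating_function_on_sphere:
  fixes F :: "'c \<Rightarrow> 'c \<Rightarrow> complex"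
  assumes hom: "X homeomorphic_space nsphere 2"
    and cont: "\<And>u v. continuous_map (top_of_set (sphere (0::complex \<times> real) 1)) X u \<Longrightarrow>
       continuous_map (top_of_set (sphere 0 1)) X v \<Longrightarrow> continuous_on (sphere 0 1) (\<lambda>p. F (u p) (v p))"
    and alt: "\<And>x y. x \<in> topspace X \<Longrightarrow> y \<in> topspace X \<Longrightarrow> F y x = - F x y"
  shows "\<exists>x\<in>topspace X. \<exists>y\<in>topspace X. x \<noteq> y \<and> F x y = 0"
proof -
  let ?S = "sphere (0::complex \<times> real) 1"
  obtain h where h: "homeomorphic_map (nsphere 2) X h"
    using hom by (metis homeomorphic_space homeomorphic_space_sym)
  define u where "u p = h (sphere_coords p)" for p
  have cu: "continuous_map (top_of_set ?S) X u"
    unfolding u_def using continuous_map_compose[OF continuous_map_sphere_coords homeomorphic_imp_continuous_map[OF h]]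
    by (simp add: o_def)
  have cv: "continuous_map (top_of_set ?S) X (\<lambda>p. u (- p))"
  proof -
    have "continuous_map (top_of_set ?S) (top_of_set ?S) uminus" by (auto intro!: continuous_intros)
    from continuous_map_compose[OF this cu] show ?thesis by (simp add: o_def)
  qed
  have mem: "u p \<in> topspace X" if "p \<in> ?S" for p
    using continuous_map_image_subset_topspace[OF cu] that by auto
  have "\<exists>p\<in>?S. F (u p) (u (- p)) = 0"
  proof (rule odd_map_on_sphere_has_zero)
    show "F (u (- p)) (u (- (- p))) = - F (u p) (u (- p))" if "p \<in> ?S" for p
      using alt[of "u p" "u (- p)"] mem that by simp
  qed (use cont[OF cu cv] in auto)
  then obtain p where p: "p \<in> ?S" "F (u p) (u (- p)) = 0" by blast
  have "sphere_coords q \<in> topspace (nsphere 2)" if "q \<in> ?S" for q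
    using continuous_map_image_subset_topspace[OF continuous_map_sphere_coords] that by auto
  then have "sphere_coords p \<in> topspace (nsphere 2)" "sphere_coords (- p) \<in> topspace (nsphere 2)"
    using p(1) by auto
  then have "u p \<noteq> u (- p)"
    using sphere_coords_neq[OF p(1)] homeomorphic_imp_injective_map[OF h]
    unfolding u_def inj_on_def by blast
  then show ?thesis using p mem[of p] mem[of "- p"] by auto
qed

section \<open>The limit map\<close>

lemma Omega_mat_entries:
  assumes "i < 2 * m" "j < 2 * m"
  shows "entries (Omega_mat m) i j = (if i < m then (if j = i + m then 1 else 0) else (if i = j + m then - 1 else 0))"
  using assms by (auto simp: entries_def Omega_mat_def)

text \<open>Left multiplication by the matrix of the form permutes the rows by the involution
  \<sigma>, up to sign.\<close>

lemma fro_Omega_mmul: "fro (2 * m) (mmul (2 * m) (entries (Omega_mat m)) a) = fro (2 * m) a"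
proof -
  define \<sigma> where "\<sigma> i = (if i < m then i + m else i - m)" for i
  have \<sigma>: "\<sigma> i < 2 * m" if "i < 2 * m" for i using that by (auto simp: \<sigma>_def)
  have "cmod (mmul (2 * m) (entries (Omega_mat m)) a i j) = cmod (a (\<sigma> i) j)" if i: "i < 2 * m" for i j
  proof -
    have "mmul (2 * m) (entries (Omega_mat m)) a i j
       = (\<Sum>k<2 * m. if k = \<sigma> i then (if i < m then 1 else - 1) * a k j else 0)"
      unfolding mmul_def by (rule sum.cong[OF refl]) (use i in \<open>auto simp: Omega_mat_entries \<sigma>_def\<close>)
    also have "\<dots> = (if i < m then 1 else - 1) * a (\<sigma> i) j" using \<sigma>[OF i] by simp
    finally show ?thesis by simp
  qed
  then have "(fro (2 * m) (mmul (2 * m) (entries (Omega_mat m)) a))\<^sup>2 = (\<Sum>i<2 * m. \<Sum>j<2 * m. (cmod (a (\<sigma> i) j))\<^sup>2)"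
    unfolding fro_sq by simp
  also have "\<dots> = (\<Sum>i<2 * m. \<Sum>j<2 * m. (cmod (a i j))\<^sup>2)"
    by (rule sum.reindex_bij_witness[of _ \<sigma> \<sigma>]) (auto simp: \<sigma>_def)
  finally show ?thesis unfolding fro_sq[symmetric] by simp
qed

section \<open>Symplectic representations: norms, growth and contraction\<close>

locale symplectic_rep = fin_gen_group G S for G :: "('a, 'b) monoid_scheme" (structure) and S +
  fixes m :: nat and \<rho> :: "'a \<Rightarrow> complex mat"
  assumes m: "1 \<le> m" and hom_Sp: "\<rho> \<in> hom G (Sp_group m)"
begin

abbreviation (input) N where "N \<equiv> 2 * m"
abbreviation (input) J where "J \<equiv> entries (Omega_mat m)"
abbreviation E where "E g \<equiv> entries (\<rho> g)"

lemma rho_carrier: "g \<in> carrier G \<Longrightarrow> \<rho> g \<in> carrier_mat N N"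
  using hom_Sp by (auto simp: hom_def Sp_group_def SL_group_def Pi_iff)

lemma entries_mult:
  assumes "g \<in> carrier G" "h \<in> carrier G" "i < N" "j < N"
  shows "E (g \<otimes> h) i j = mmul N (E g) (E h) i j"
proof -
  have "\<rho> (g \<otimes> h) = \<rho> g * \<rho> h" using hom_Sp assms by (simp add: hom_def Sp_group_def SL_group_def)
  then show ?thesis using mult_mat_index[OF rho_carrier rho_carrier] assms by (simp add: entries_def mmul_def)
qed

lemma J_bound: "i < N \<Longrightarrow> j < N \<Longrightarrow> cmod (J i j) \<le> 1"
  by (simp add: Omega_mat_entries)

lemma J_skew: "i < N \<Longrightarrow> j < N \<Longrightarrow> J j i = - J i j"
  by (auto simp: Omega_mat_entries)

lemma symplectic_form_entries:
  assumes "u \<in> carrier_vec N" "v \<in> carrier_vec N"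
  shows "symplectic_form m u v = (\<Sum>i<N. \<Sum>j<N. vec_index u i * J i j * vec_index v j)"
proof -
  have O: "Omega_mat m \<in> carrier_mat N N" by (auto simp: Omega_mat_def)
  show ?thesis using assms O
    by (simp add: symplectic_form_def scalar_prod_def entries_def lessThan_atLeast0 sum_distrib_left mult.assoc)
qed

lemma pairing_invariant:
  assumes "g \<in> carrier G" "p < N" "q < N"
  shows "pairing N J (E g) (E g) p q = J p q"
proof -
  have c: "\<rho> g \<in> carrier_mat N N" using rho_carrier[OF assms(1)] .
  have u: "\<rho> g *\<^sub>v unit_vec N p = col (\<rho> g) p" if "p < N" for p
    using c that by (intro eq_vecI) auto
  have "symplectic_form m (col (\<rho> g) p) (col (\<rho> g) q) = symplectic_form m (unit_vec N p) (unit_vec N q)"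
  proof -
    have "\<rho> g \<in> carrier (Sp_group m)" using hom_Sp assms(1) by (auto simp: hom_def)
    then have "symplectic_form m (\<rho> g *\<^sub>v unit_vec N p) (\<rho> g *\<^sub>v unit_vec N q) = symplectic_form m (unit_vec N p) (unit_vec N q)"
      by (simp add: Sp_group_def)
    then show ?thesis unfolding u[OF assms(2)] u[OF assms(3)] .
  qed
  moreover have "symplectic_form m (col (\<rho> g) p) (col (\<rho> g) q) = pairing N J (E g) (E g) p q"
    using c assms by (subst symplectic_form_entries) (auto simp: pairing_def entries_def)
  moreover have "symplectic_form m (unit_vec N p) (unit_vec N q) = J p q"
  proof -
    have "symplectic_form m (unit_vec N p) (unit_vec N q)
      = (\<Sum>i<N. \<Sum>j<N. if j = q then (if i = p then J i j else 0) else 0)"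
      unfolding symplectic_form_entries[OF unit_vec_carrier unit_vec_carrier]
      by (intro sum.cong refl) (use assms in auto)
    also have "\<dots> = J p q" using assms by simp
    finally show ?thesis .
  qed
  ultimately show ?thesis by simp
qed

text \<open>g^T J h = (g^T J g) (g^-1 h) = J (g^-1 h), and J preserves the Frobenius norm. This
  provides the hypothesis \<open>pair\<close> of \<open>line_not_degenerate\<close>.\<close>

lemma fro_pairing_entries:
  assumes g: "g \<in> carrier G" and h: "h \<in> carrier G"
  shows "fro N (pairing N J (E g) (E h)) = fro N (E (inv g \<otimes> h))"
proof -
  let ?k = "inv g \<otimes> h"
  have k: "?k \<in> carrier G" "g \<otimes> ?k = h" using g h by (auto simp flip: m_assoc)
  have "pairing N J (E g) (E h) p q = mmul N J (E ?k) p q" if "p < N" "q < N" for p q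
  proof -
    have "pairing N J (E g) (E h) p q = pairing N J (E g) (mmul N (E g) (E ?k)) p q"
      unfolding pairing_def using entries_mult[OF g k(1)] k(2) that by (intro sum.cong refl) simp
    also have "\<dots> = mmul N (pairing N J (E g) (E g)) (E ?k) p q"
      by (rule pairing_mmul_right)
    also have "\<dots> = mmul N J (E ?k) p q"
      unfolding mmul_def using pairing_invariant[OF g] that by simp
    finally show ?thesis .
  qed
  then have "fro N (pairing N J (E g) (E h)) = fro N (mmul N J (E ?k))" by (intro fro_cong) simp
  then show ?thesis by (simp add: fro_Omega_mmul)
qed

text \<open>Pairing g with the identity gives the norm of the inverse of g, pairing in the other
  order the norm of g. Since J is skew, the two pairing matrices are transposes of each other up to
  sign.\<close>

lemma fro_inv: assumes "g \<in> carrier G" shows "fro N (E (inv g)) = fro N (E g)"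
proof -
  have skew: "cmod (pairing N J (E g) (E \<one>) q p) = cmod (pairing N J (E \<one>) (E g) p q)" for p q
    using pairing_skew[where N = N and J = J and a = "E \<one>" and b = "E g", OF J_skew] by simp
  have "fro N (E (inv g)) = fro N (pairing N J (E g) (E \<one>))"
    using fro_pairing_entries[OF assms one_closed] assms by simp
  also have "\<dots> = fro N (\<lambda>p q. pairing N J (E g) (E \<one>) q p)" by (rule fro_transpose[symmetric])
  also have "\<dots> = fro N (pairing N J (E \<one>) (E g))"
    by (intro fro_cong skew)
  also have "\<dots> = fro N (E g)" using fro_pairing_entries[OF one_closed assms] assms by simp
  finally show ?thesis .
qed

text \<open>The matrix g^T J g = J has an entry of modulus 1, while its norm is at most the square
  of the norm of g.\<close>

lemma fro_ge_1: assumes g: "g \<in> carrier G" shows "1 \<le> fro N (E g)"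
proof -
  have "1 = cmod (J 0 m)" using m by (simp add: Omega_mat_entries)
  also have "\<dots> = cmod (pairing N J (E g) (E g) 0 m)" using m pairing_invariant[OF g] by simp
  also have "\<dots> \<le> fro N (pairing N J (E g) (E g))" using m by (intro cmod_le_fro) auto
  also have "\<dots> = fro N (mmul N (\<lambda>p i. E g i p) (mmul N J (E g)))"
    by (intro fro_cong) (simp add: pairing_eq_mmul)
  also have "\<dots> \<le> fro N (E g) * fro N (E g)"
    using fro_mmul[of N "\<lambda>p i. E g i p" "mmul N J (E g)"]
    unfolding fro_transpose[of N "E g"] fro_Omega_mmul .
  finally have "1\<^sup>2 \<le> (fro N (E g))\<^sup>2" by (simp add: power2_eq_square)
  then show ?thesis by (rule power2_le_imp_le) simp
qed

lemma fro_mult: "g \<in> carrier G \<Longrightarrow> h \<in> carrier G \<Longrightarrow> fro N (E (g \<otimes> h)) \<le> fro N (E g) * fro N (E h)"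
  using fro_mmul[of N "E g" "E h"] fro_cong[of N "E (g \<otimes> h)" "mmul N (E g) (E h)"] entries_mult by simp

lemma ex_growth: "\<exists>K\<ge>1. \<forall>g\<in>carrier G. fro N (E g) \<le> fro N (E \<one>) * K ^ word_length G S g"
  using submultiplicative_le_word_length[of "\<lambda>g. fro N (E g)"] fro_mult by (metis fro_nonneg)

text \<open>The constants are 2 N / c and exp (- \<mu>), obtained from
  \<open>minor_bound_singular_values\<close> with the Anosov lower bound as
  \<open>t\<close>.\<close>

lemma ex_contraction:
  assumes anosov: "anosov G S (2 * m) 1 \<rho>"
  shows "\<exists>c q. 0 < c \<and> 0 < q \<and> q < 1 \<and> (\<forall>g\<in>carrier G. minor_bound N (E g) (c * q ^ word_length G S g))"
proof -
  obtain c \<mu> where c: "0 < c" and mu: "0 < \<mu>" and gap: "\<And>g. g \<in> carrier G \<Longrightarrow>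
      c * exp (\<mu> * real (word_length G S g)) \<le> singular_value 1 (\<rho> g) / singular_value 2 (\<rho> g)"
    using anosov unfolding anosov_def by (auto simp: numeral_2_eq_2)
  have "minor_bound N (E g) (2 * real N / c * exp (- \<mu>) ^ word_length G S g)" if g: "g \<in> carrier G" for g
  proof -
    have "2 * real N / (c * exp (\<mu> * real (word_length G S g))) = 2 * real N / c * exp (- \<mu>) ^ word_length G S g"
      by (simp add: exp_minus exp_of_nat2_mult power_inverse field_simps)
    then show ?thesis
      using minor_bound_singular_values[OF rho_carrier[OF g] _ _ gap[OF g]] c m by simp
  qed
  moreover have "0 < 2 * real N / c" "0 < exp (- \<mu>)" "exp (- \<mu>) < 1" using c mu m by auto
  ultimately show ?thesis by blast
qed

end

section \<open>Limit lines along geodesic rays\<close>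

locale contracting_symplectic_rep = symplectic_rep +
  fixes K c q :: real
  assumes hyperbolic: "gromov_hyperbolic (carrier G) (word_dist G S)"
    and K: "1 \<le> K" "g \<in> carrier G \<Longrightarrow> fro (2 * m) (E g) \<le> fro (2 * m) (E \<one>) * K ^ word_length G S g"
    and cq: "0 < c" "0 < q" "q < 1"
      "g \<in> carrier G \<Longrightarrow> minor_bound (2 * m) (E g) (c * q ^ word_length G S g)"
begin

text \<open>The inverse of the element from \<open>g\<close> to \<open>h\<close> plays the part of
  \<open>k'\<close> in \<open>range_proj_mmul_close\<close>. By \<open>fro_inv\<close> it has the
  same norm, hence the square.\<close>

lemma range_proj_close:
  assumes g: "g \<in> carrier G" and h: "h \<in> carrier G" and ij: "i < N" "j < N"
  shows "cmod (range_proj N (E h) i j - range_proj N (E g) i j)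
     \<le> 2 * real N ^ 4 * (c * q ^ word_length G S g) * (fro N (E (inv g \<otimes> h)))\<^sup>2"
proof -
  let ?k = "inv g \<otimes> h"
  have k: "?k \<in> carrier G" "g \<otimes> ?k = h" "h \<otimes> inv ?k = g"
    using g h by (auto simp: inv_mult_group simp flip: m_assoc)
  have "range_proj N (E h) i j = range_proj N (mmul N (E g) (E ?k)) i j"
    using entries_mult[OF g k(1)] k(2) ij by (intro range_proj_cong) auto
  moreover have "cmod (range_proj N (mmul N (E g) (E ?k)) i j - range_proj N (E g) i j)
     \<le> 2 * real N ^ 4 * (c * q ^ word_length G S g) * fro N (E ?k) * fro N (E (inv ?k))"
  proof (rule range_proj_mmul_close[OF cq(4)[OF g]])
    show "0 \<le> c * q ^ word_length G S g" using cq by simp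
    show "E g a b = mmul N (mmul N (E g) (E ?k)) (E (inv ?k)) a b" if "a < N" "b < N" for a b
    proof -
      have "E g a b = mmul N (E h) (E (inv ?k)) a b"
        using entries_mult[OF h inv_closed[OF k(1)] that] k(3) by simp
      also have "\<dots> = mmul N (mmul N (E g) (E ?k)) (E (inv ?k)) a b"
        unfolding mmul_def[of N _ "E (inv ?k)"] using entries_mult[OF g k(1)] k(2) that by simp
      finally show ?thesis .
    qed
    show "0 < fro N (E g)" using fro_ge_1[OF g] by simp
  qed (use ij in auto)
  ultimately show ?thesis using fro_inv[OF k(1)] by (simp add: power2_eq_square mult.assoc)
qed

text \<open>The constant of \<open>range_proj_close\<close> for neighbours in the Cayley graph,
  where \<open>fro_adjacent\<close> bounds the norm of the step.\<close>

definition rate where "rate = 2 * real N ^ 4 * c * (fro N (E \<one>) * K)\<^sup>2"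

lemma fro_adjacent:
  assumes "g \<in> carrier G" "h \<in> carrier G" "word_dist G S g h = 1"
  shows "fro N (E (inv g \<otimes> h)) \<le> fro N (E \<one>) * K"
  using K(2)[of "inv g \<otimes> h"] assms by (simp add: word_dist_def)

lemma range_proj_ray_step:
  assumes r: "r \<in> geodesic_rays G S" and ij: "i < N" "j < N"
  shows "cmod (range_proj N (E (r (Suc n))) i j - range_proj N (E (r n)) i j) \<le> rate * q ^ n"
proof -
  let ?k = "inv (r n) \<otimes> r (Suc n)"
  have "cmod (range_proj N (E (r (Suc n))) i j - range_proj N (E (r n)) i j)
    \<le> 2 * real N ^ 4 * (c * q ^ n) * (fro N (E ?k))\<^sup>2"
    using range_proj_close[OF ray_carrier[OF r] ray_carrier[OF r] ij, of "Suc n" n] ray_length[OF r] by simp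
  also have "\<dots> \<le> 2 * real N ^ 4 * (c * q ^ n) * (fro N (E \<one>) * K)\<^sup>2"
    using cq by (intro mult_left_mono power_mono fro_adjacent ray_carrier[OF r]) (auto simp: ray_dist[OF r])
  finally show ?thesis unfolding rate_def by (simp add: mult_ac)
qed

definition ray_limit :: "(nat \<Rightarrow> 'a) \<Rightarrow> nat \<Rightarrow> nat \<Rightarrow> complex" where
  "ray_limit r i j = lim (\<lambda>n. range_proj N (E (r n)) i j)"

lemma ray_limit:
  assumes "r \<in> geodesic_rays G S" "i < N" "j < N"
  shows "(\<lambda>n. range_proj N (E (r n)) i j) \<longlonglongrightarrow> ray_limit r i j"
    "cmod (range_proj N (E (r n)) i j - ray_limit r i j) \<le> rate / (1 - q) * q ^ n"
  using geometric_limit[of "\<lambda>n. range_proj N (E (r n)) i j", OF range_proj_ray_step[OF assms] cq(2,3)]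
  unfolding ray_limit_def .

text \<open>The elements from \<open>r n\<close> to \<open>s n\<close> have bounded length, hence
  bounded norm, whereas the factor \<open>q ^ n\<close> in \<open>range_proj_close\<close> tends to
  0.\<close>

lemma ray_limit_asymptotic:
  assumes rs: "(r, s) \<in> asymptotic_rel G S" and ij: "i < N" "j < N"
  shows "ray_limit r i j = ray_limit s i j"
proof -
  from rs obtain C where r: "r \<in> geodesic_rays G S" and s: "s \<in> geodesic_rays G S"
    and C: "\<And>n. word_dist G S (r n) (s n) \<le> C"
    unfolding asymptotic_rel_def by blast
  obtain M :: nat where M: "C \<le> real M" using real_arch_simple by blast
  define B where "B = fro N (E \<one>) * K ^ M"
  have bound: "fro N (E (inv (r n) \<otimes> s n)) \<le> B" for n
  proof -
    have "word_length G S (inv (r n) \<otimes> s n) \<le> M" using C[of n] M unfolding word_dist_def by linarith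
    then have "K ^ word_length G S (inv (r n) \<otimes> s n) \<le> K ^ M" using K(1) by (rule power_increasing)
    then show ?thesis
      using K(2)[of "inv (r n) \<otimes> s n"] ray_carrier[OF r] ray_carrier[OF s] mult_left_mono[of _ _ "fro N (E \<one>)"]
      unfolding B_def by (meson fro_nonneg inv_closed m_closed order_trans)
  qed
  have "(\<lambda>n. range_proj N (E (s n)) i j - range_proj N (E (r n)) i j) \<longlonglongrightarrow> 0"
  proof (rule Lim_null_comparison)
    show "\<forall>\<^sub>F n in sequentially. norm (range_proj N (E (s n)) i j - range_proj N (E (r n)) i j)
        \<le> 2 * real N ^ 4 * (c * q ^ n) * B\<^sup>2"
    proof (rule always_eventually, rule allI)
      fix n
      have "cmod (range_proj N (E (s n)) i j - range_proj N (E (r n)) i j)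
        \<le> 2 * real N ^ 4 * (c * q ^ n) * (fro N (E (inv (r n) \<otimes> s n)))\<^sup>2"
        using range_proj_close[OF ray_carrier[OF r] ray_carrier[OF s] ij, of n n] ray_length[OF r] by simp
      also have "\<dots> \<le> 2 * real N ^ 4 * (c * q ^ n) * B\<^sup>2"
        using cq by (intro mult_left_mono power_mono bound) auto
      finally show "cmod (range_proj N (E (s n)) i j - range_proj N (E (r n)) i j)
        \<le> 2 * real N ^ 4 * (c * q ^ n) * B\<^sup>2" .
    qed
    have "(\<lambda>n. 2 * real N ^ 4 * (c * q ^ n) * B\<^sup>2) \<longlonglongrightarrow> 2 * real N ^ 4 * (c * 0) * B\<^sup>2"
      using cq by (intro tendsto_intros LIMSEQ_power_zero) auto
    then show "(\<lambda>n. 2 * real N ^ 4 * (c * q ^ n) * B\<^sup>2) \<longlonglongrightarrow> 0" by simp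
  qed
  moreover have "(\<lambda>n. range_proj N (E (s n)) i j - range_proj N (E (r n)) i j) \<longlonglongrightarrow> ray_limit s i j - ray_limit r i j"
    by (intro tendsto_diff ray_limit r s ij)
  ultimately show ?thesis using LIMSEQ_unique by fastforce
qed

lemma ray_limit_hermitian:
  assumes "r \<in> geodesic_rays G S" "i < N" "j < N"
  shows "cnj (ray_limit r j i) = ray_limit r i j"
proof -
  have "(\<lambda>n. cnj (range_proj N (E (r n)) j i)) \<longlonglongrightarrow> cnj (ray_limit r j i)"
    by (intro tendsto_cnj ray_limit assms)
  then show ?thesis unfolding range_proj_hermitian using ray_limit(1)[OF assms] LIMSEQ_unique by blast
qed

lemma ray_limit_minor:
  assumes r: "r \<in> geodesic_rays G S" and ij: "i < N" "j < N" "k < N" "l < N"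
  shows "ray_limit r i j * ray_limit r k l = ray_limit r i l * ray_limit r k j"
proof -
  let ?P = "\<lambda>n. range_proj N (E (r n))"
  have "(\<lambda>n. ?P n i j * ?P n k l - ?P n i l * ?P n k j) \<longlonglongrightarrow> 0"
  proof (rule Lim_null_comparison)
    show "\<forall>\<^sub>F n in sequentially. norm (?P n i j * ?P n k l - ?P n i l * ?P n k j) \<le> (real N)\<^sup>2 * (c * q ^ n)"
    proof (rule always_eventually, rule allI)
      fix n
      have "minor_bound N (E (r n)) (c * q ^ n)"
        using cq(4)[OF ray_carrier[OF r]] ray_length[OF r] by metis
      moreover have "0 < fro N (E (r n))" using fro_ge_1[OF ray_carrier[OF r], of n] by linarith
      ultimately show "norm (?P n i j * ?P n k l - ?P n i l * ?P n k j) \<le> (real N)\<^sup>2 * (c * q ^ n)"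
        using ij by (intro range_proj_minor)
    qed
    have "(\<lambda>n. (real N)\<^sup>2 * (c * q ^ n)) \<longlonglongrightarrow> (real N)\<^sup>2 * (c * 0)"
      using cq by (intro tendsto_intros LIMSEQ_power_zero) auto
    then show "(\<lambda>n. (real N)\<^sup>2 * (c * q ^ n)) \<longlonglongrightarrow> 0" by simp
  qed
  moreover have "(\<lambda>n. ?P n i j * ?P n k l - ?P n i l * ?P n k j) \<longlonglongrightarrow>
      ray_limit r i j * ray_limit r k l - ray_limit r i l * ray_limit r k j"
    by (intro tendsto_intros ray_limit r ij)
  ultimately have "ray_limit r i j * ray_limit r k l - ray_limit r i l * ray_limit r k j = 0"
    using LIMSEQ_unique by blast
  then show ?thesis by simp
qed

text \<open>The n-th approximation depends only on the vertex \<open>r n\<close>, a coordinate with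
  discrete values, and the error bound in \<open>ray_limit\<close> is the same for all rays.\<close>

lemma continuous_map_ray_limit:
  assumes ij: "i < N" "j < N"
  shows "continuous_map (ray_topology G S) euclidean (\<lambda>r. ray_limit r i j)"
  unfolding mtopology_is_euclidean[symmetric]
proof (rule Met_TC.continuous_map_uniform_limit[where F = sequentially and f = "\<lambda>n r. range_proj N (E (r n)) i j"])
  have "continuous_map (ray_topology G S) (discrete_topology (carrier G)) (\<lambda>r. r n)" for n
    unfolding ray_topology_def
    by (intro continuous_map_from_subtopology continuous_map_product_projection) simp
  then have "continuous_map (ray_topology G S) euclidean ((\<lambda>g. range_proj N (E g) i j) \<circ> (\<lambda>r. r n))" for n
    by (rule continuous_map_compose) (simp add: continuous_map_from_discrete_topology)
  then show "\<forall>\<^sub>F n in sequentially. continuous_map (ray_topology G S) Met_TC.mtopology (\<lambda>r. range_proj N (E (r n)) i j)"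
    by (simp add: o_def)
next
  fix e :: real assume e: "0 < e"
  have "(\<lambda>n. rate / (1 - q) * q ^ n) \<longlonglongrightarrow> rate / (1 - q) * 0"
    using cq by (intro tendsto_intros LIMSEQ_power_zero) auto
  then have "\<forall>\<^sub>F n in sequentially. rate / (1 - q) * q ^ n < e"
    by (rule order_tendstoD) (use e in simp)
  then show "\<forall>\<^sub>F n in sequentially. \<forall>r\<in>topspace (ray_topology G S). ray_limit r i j \<in> UNIV \<and>
       dist (range_proj N (E (r n)) i j) (ray_limit r i j) < e"
  proof eventually_elim
    case (elim n)
    then show ?case using ray_limit(2)[OF _ ij, of _ n] by (fastforce simp: dist_norm)
  qed
qed simp

text \<open>The reversed ray \<open>r\<close> followed by \<open>s\<close> is a path on which word
  lengths fall short of index differences by at most a constant, so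
  \<open>line_not_degenerate\<close> applies to it.\<close>

lemma ray_limit_transverse:
  assumes r: "r \<in> geodesic_rays G S" and s: "s \<in> geodesic_rays G S" and ne: "(r, s) \<notin> asymptotic_rel G S"
  shows "\<exists>i<N. \<exists>j<N. pairing N J (ray_limit r) (ray_limit s) i j \<noteq> 0"
proof (rule ccontr)
  assume "\<not> ?thesis"
  then have zero: "pairing N J (ray_limit r) (ray_limit s) i j = 0" if "i < N" "j < N" for i j
    using that by blast
  obtain C where C: "\<And>n k. word_dist G S (r n) (s k) \<ge> real n + real k - C"
    using nonasymptotic_rays_diverge[OF hyperbolic r s ne] by blast
  obtain D :: nat where D: "C \<le> real D" using real_arch_simple by blast
  \<comment> \<open>Index 0 belongs to \<open>s\<close>; as both rays start at the identity, the
    formula for \<open>r\<close> holds there too.\<close>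
  define \<gamma> where "\<gamma> k = (if 0 \<le> k then s (nat k) else r (nat (- k)))" for k :: int
  have \<gamma>c [simp]: "\<gamma> k \<in> carrier G" for k using ray_carrier r s by (simp add: \<gamma>_def)
  have \<gamma>neg: "\<gamma> (- int n) = r n" for n using ray_0[OF r] ray_0[OF s] by (cases "n = 0") (auto simp: \<gamma>_def)
  have \<gamma>pos: "\<gamma> (int n) = s n" for n by (simp add: \<gamma>_def)
  have dist_le: "real_of_int (j - i) \<le> word_dist G S (\<gamma> i) (\<gamma> j) + real D" if ij: "i \<le> j" for i j
  proof -
    consider "0 \<le> i" | "j < 0" | "i < 0" "0 \<le> j" by linarith
    then show ?thesis
    proof cases
      case 1
      then have "word_dist G S (\<gamma> i) (\<gamma> j) = \<bar>real (nat i) - real (nat j)\<bar>" using ij ray_dist[OF s] by (simp add: \<gamma>_def)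
      then show ?thesis using 1 ij by simp
    next
      case 2
      then have "word_dist G S (\<gamma> i) (\<gamma> j) = \<bar>real (nat (- i)) - real (nat (- j))\<bar>" using ij ray_dist[OF r] by (simp add: \<gamma>_def)
      then show ?thesis using 2 ij by simp
    next
      case 3
      then have "word_dist G S (\<gamma> i) (\<gamma> j) \<ge> real (nat (- i)) + real (nat j) - C"
        using C[of "nat (- i)" "nat j"] by (simp add: \<gamma>_def)
      then show ?thesis using 3 D by simp
    qed
  qed
  have len: "nat \<bar>i - j\<bar> \<le> word_length G S (inv (\<gamma> i) \<otimes> \<gamma> j) + D" for i j
  proof -
    have "real_of_int \<bar>i - j\<bar> \<le> word_dist G S (\<gamma> i) (\<gamma> j) + real D"
      using dist_le[of i j] dist_le[of j i] word_dist_sym[of "\<gamma> i" "\<gamma> j"] by (cases "i \<le> j") auto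
    then show ?thesis unfolding word_dist_def by linarith
  qed
  define h where "h i j = E (inv (\<gamma> i) \<otimes> \<gamma> j)" for i j
  have h0: "h 0 j = E (\<gamma> j)" for j unfolding h_def using ray_0[OF s] by (simp add: \<gamma>_def[of 0])
  have inv_mult: "inv (inv a \<otimes> b) \<otimes> (inv a \<otimes> c) = inv b \<otimes> c" if "a \<in> carrier G" "b \<in> carrier G" "c \<in> carrier G" for a b c
  proof -
    have "a \<otimes> (inv a \<otimes> c) = c" using that by (simp flip: m_assoc)
    then show ?thesis using that by (simp add: inv_mult_group m_assoc)
  qed
  show False
  \<comment> \<open>Dividing \<open>c\<close> by \<open>q ^ D\<close> compensates for the deficit
    \<open>D\<close> between word length and index difference in the exponent of
    \<open>q\<close>.\<close>
  proof (rule line_not_degenerate[of N J h "fro N (E \<one>) * K" q "c / q ^ D", OF J_bound])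
    show "1 \<le> fro N (h i j)" for i j unfolding h_def by (rule fro_ge_1) simp
    show "fro N (h i j) = fro N (h j i)" for i j
      unfolding h_def using fro_inv[of "inv (\<gamma> j) \<otimes> \<gamma> i"] by (simp add: inv_mult_group)
    show "fro N (pairing N J (h k i) (h k j)) = fro N (h i j)" for i j k
      unfolding h_def by (simp add: fro_pairing_entries inv_mult)
    show "h i k a b = mmul N (h i j) (h j k) a b" if "a < N" "b < N" for i j k a b
    proof -
      have "\<gamma> j \<otimes> (inv (\<gamma> j) \<otimes> \<gamma> k) = \<gamma> k" by (simp flip: m_assoc)
      then have "inv (\<gamma> i) \<otimes> \<gamma> k = (inv (\<gamma> i) \<otimes> \<gamma> j) \<otimes> (inv (\<gamma> j) \<otimes> \<gamma> k)" by (simp add: m_assoc)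
      then show ?thesis unfolding h_def using entries_mult[of "inv (\<gamma> i) \<otimes> \<gamma> j" "inv (\<gamma> j) \<otimes> \<gamma> k"] that by simp
    qed
    show "fro N (h i (i + 1)) \<le> fro N (E \<one>) * K" for i
      unfolding h_def
    proof (rule fro_adjacent)
      show "word_dist G S (\<gamma> i) (\<gamma> (i + 1)) = 1"
      proof (cases "0 \<le> i")
        case True
        then show ?thesis using ray_dist[OF s] by (simp add: \<gamma>_def nat_add_distrib)
      next
        case False
        then have "\<gamma> i = r (nat (- i))" "\<gamma> (i + 1) = r (nat (- i - 1))"
          using \<gamma>neg[of "nat (- i)"] \<gamma>neg[of "nat (- i - 1)"] by (auto simp: add.commute)
        then show ?thesis using ray_dist[OF r] False by simp
      qed
    qed auto
    show "minor_bound N (h i j) (c / q ^ D * q ^ nat \<bar>i - j\<bar>)" for i j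
    proof -
      have "q ^ (word_length G S (inv (\<gamma> i) \<otimes> \<gamma> j) + D) \<le> q ^ nat \<bar>i - j\<bar>"
        using cq len by (intro power_decreasing) auto
      then have "c * q ^ word_length G S (inv (\<gamma> i) \<otimes> \<gamma> j) \<le> c / q ^ D * q ^ nat \<bar>i - j\<bar>"
        using cq by (simp add: field_simps power_add)
      then show ?thesis unfolding h_def by (intro minor_bound_mono[OF cq(4)]) auto
    qed
    show "(\<lambda>n. pairing N J (range_proj N (h 0 (- int n))) (range_proj N (h 0 (int n))) a b) \<longlonglongrightarrow> 0"
      if "a < N" "b < N" for a b
    proof -
      have "(\<lambda>n. pairing N J (range_proj N (E (r n))) (range_proj N (E (s n))) a b)
         \<longlonglongrightarrow> pairing N J (ray_limit r) (ray_limit s) a b"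
        unfolding pairing_def using that by (intro tendsto_intros ray_limit r s) auto
      then show ?thesis unfolding h0 \<gamma>neg \<gamma>pos zero[OF that] .
    qed
  qed (use cq in auto)
qed

section \<open>The limit map on the boundary and the excluded sphere\<close>

definition boundary_limit :: "(nat \<Rightarrow> 'a) set \<Rightarrow> nat \<Rightarrow> nat \<Rightarrow> complex" where
  "boundary_limit x = ray_limit (SOME r. r \<in> x)"

text \<open>Independence of the chosen representative comes from
  \<open>ray_limit_asymptotic\<close>, which speaks of indices below N only.\<close>

lemma boundary_limit_class:
  assumes r: "r \<in> geodesic_rays G S" and ij: "i < N" "j < N"
  shows "boundary_limit (asymptotic_rel G S `` {r}) i j = ray_limit r i j"
proof -
  have "r \<in> asymptotic_rel G S `` {r}" using equiv_class_self[OF equiv_asymptotic_rel r] .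
  then have "(SOME s. s \<in> asymptotic_rel G S `` {r}) \<in> asymptotic_rel G S `` {r}"
    by (rule someI[of "\<lambda>s. s \<in> asymptotic_rel G S `` {r}"])
  then show ?thesis unfolding boundary_limit_def using ray_limit_asymptotic[OF _ ij] by (metis Image_singleton_iff)
qed

lemma continuous_map_boundary_limit:
  assumes ij: "i < N" "j < N"
  shows "continuous_map (gromov_boundary G S) euclidean (\<lambda>x. boundary_limit x i j)"
proof (rule continuous_compose_quotient_map[OF quotient_map_gromov_boundary])
  show "continuous_map (ray_topology G S) euclidean ((\<lambda>x. boundary_limit x i j) \<circ> (\<lambda>r. asymptotic_rel G S `` {r}))"
    using continuous_map_ray_limit[OF ij] by (rule continuous_map_eq) (simp add: boundary_limit_class ij)
qed

lemma boundary_limit_transverse: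
  assumes "x \<in> topspace (gromov_boundary G S)" "y \<in> topspace (gromov_boundary G S)" "x \<noteq> y"
  shows "\<exists>i<N. \<exists>j<N. pairing N J (boundary_limit x) (boundary_limit y) i j \<noteq> 0"
proof -
  obtain r s where r: "r \<in> geodesic_rays G S" "x = asymptotic_rel G S `` {r}"
    and s: "s \<in> geodesic_rays G S" "y = asymptotic_rel G S `` {s}"
    using assms by (auto elim!: quotientE)
  have "(r, s) \<notin> asymptotic_rel G S"
    using assms(3) r s equiv_class_eq[OF equiv_asymptotic_rel] by blast
  then obtain i j where ij: "i < N" "j < N" "pairing N J (ray_limit r) (ray_limit s) i j \<noteq> 0"
    using ray_limit_transverse r s by blast
  moreover have "pairing N J (boundary_limit x) (boundary_limit y) i j = pairing N J (ray_limit r) (ray_limit s) i j"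
    unfolding pairing_def r(2) s(2) using ij by (intro sum.cong refl) (simp add: boundary_limit_class r s)
  ultimately show ?thesis by metis
qed

lemma boundary_limit_hermitian:
  "\<lbrakk>x \<in> topspace (gromov_boundary G S); i < N; j < N\<rbrakk> \<Longrightarrow> cnj (boundary_limit x j i) = boundary_limit x i j"
  by (auto elim!: quotientE simp: boundary_limit_class ray_limit_hermitian)

lemma boundary_limit_minor:
  "\<lbrakk>x \<in> topspace (gromov_boundary G S); i < N; j < N; k < N; l < N\<rbrakk> \<Longrightarrow>
     boundary_limit x i j * boundary_limit x k l = boundary_limit x i l * boundary_limit x k j"
  by (auto elim!: quotientE simp: boundary_limit_class intro: ray_limit_minor)

lemma no_proper_sphere:
  assumes A: "A \<subset> topspace (gromov_boundary G S)"
    and hom: "subtopology (gromov_boundary G S) A homeomorphic_space nsphere 2"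
  shows False
proof -
  let ?X = "subtopology (gromov_boundary G S) A"
  have X: "topspace ?X = A" using A by auto
  obtain z where z: "z \<in> topspace (gromov_boundary G S)" "z \<notin> A" using A by blast
  have "?X \<noteq> trivial_topology" using hom homeomorphic_empty_space nonempty_nsphere by blast
  then obtain x0 where x0: "x0 \<in> A" using X by fastforce
  note zminor = boundary_limit_minor[OF z(1)]
  \<comment> \<open>The projection over \<open>z\<close> cannot vanish because it pairs nontrivially
    with the one over \<open>x0\<close>. Its nonzero column \<open>l\<close> will represent the line
    over \<open>z\<close>.\<close>
  have "\<exists>k<N. \<exists>l<N. boundary_limit z k l \<noteq> 0"
  proof (rule ccontr)
    assume "\<not> ?thesis"
    then have "pairing N J (boundary_limit z) (boundary_limit x0) i j = 0" if "i < N" for i j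
      using that unfolding pairing_def by (intro sum.neutral ballI) auto
    then show False using boundary_limit_transverse[OF z(1), of x0] x0 z(2) A by blast
  qed
  then obtain k l where kl: "k < N" "l < N" "boundary_limit z k l \<noteq> 0" by blast
  \<comment> \<open>With w the fixed column \<open>l\<close> over \<open>z\<close>, this is the
    projection over \<open>x\<close> applied to the conjugate of J^T w: a vector on the line over
    \<open>x\<close> that varies continuously with \<open>x\<close>.\<close>
  define y where "y x i = cnj (pairing N J (boundary_limit z) (boundary_limit x) l i)" for x i
  have y_rank: "boundary_limit x i j * y x b = y x i * boundary_limit x b j"
    if "x \<in> A" "i < N" "j < N" "b < N" for x i j b
    unfolding y_def using that A
    by (intro vec_pairing_lift boundary_limit_hermitian boundary_limit_minor) auto
  have y_nz: "\<exists>i<N. y x i \<noteq> 0" if x: "x \<in> A" for x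
  proof -
    obtain i j where "i < N" "j < N" "pairing N J (boundary_limit z) (boundary_limit x) i j \<noteq> 0"
      using boundary_limit_transverse[OF z(1), of x] x z(2) A by blast
    then show ?thesis unfolding y_def
      using pairing_column_nonzero[of N "boundary_limit z" J "boundary_limit x" i j k l, OF zminor] kl by auto
  qed
  define F where "F x x' = (\<Sum>i<N. \<Sum>j<N. y x i * J i j * y x' j)" for x x'
  have cont_y: "continuous_on (sphere 0 1) (\<lambda>p. y (u p) i)"
    if u: "continuous_map (top_of_set (sphere 0 1)) ?X u" and i: "i < N" for u :: "complex \<times> real \<Rightarrow> _" and i
  proof -
    have "continuous_on (sphere 0 1) (\<lambda>p. boundary_limit (u p) a b)" if "a < N" "b < N" for a b
    proof -
      have "continuous_map (top_of_set (sphere 0 1)) euclidean ((\<lambda>x. boundary_limit x a b) \<circ> u)"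
        using u by (intro continuous_map_compose[OF _ continuous_map_boundary_limit[OF that]])
          (simp add: continuous_map_in_subtopology)
      then show ?thesis by (simp add: o_def)
    qed
    then show ?thesis unfolding y_def pairing_def using i by (intro continuous_intros) auto
  qed
  have "\<exists>x\<in>topspace ?X. \<exists>x'\<in>topspace ?X. x \<noteq> x' \<and> F x x' = 0"
  proof (rule alternating_function_on_sphere[OF hom])
    show "continuous_on (sphere 0 1) (\<lambda>p. F (u p) (v p))"
      if "continuous_map (top_of_set (sphere 0 1)) ?X u" "continuous_map (top_of_set (sphere 0 1)) ?X v"
      for u v :: "complex \<times> real \<Rightarrow> _"
      unfolding F_def using that by (intro continuous_intros cont_y) auto
    show "F x' x = - F x x'" for x x'
    proof -
      have "F x' x = (\<Sum>i<N. \<Sum>j<N. y x' j * J j i * y x i)" unfolding F_def by (rule sum.swap)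
      also have "\<dots> = (\<Sum>i<N. \<Sum>j<N. - (y x i * J i j * y x' j))"
      proof (intro sum.cong refl)
        fix i j assume "i \<in> {..<N}" "j \<in> {..<N}"
        then show "y x' j * J j i * y x i = - (y x i * J i j * y x' j)" using J_skew[of i j] by simp
      qed
      finally show ?thesis unfolding F_def by (simp add: sum_negf)
    qed
  qed
  then obtain x x' where x: "x \<in> A" "x' \<in> A" "x \<noteq> x'" "F x x' = 0" unfolding X by blast
  obtain i j where ij: "i < N" "j < N" "pairing N J (boundary_limit x) (boundary_limit x') i j \<noteq> 0"
    using boundary_limit_transverse[of x x'] x A by blast
  obtain a b where "a < N" "y x a \<noteq> 0" "b < N" "y x' b \<noteq> 0" using y_nz x by blast
  then have "F x x' \<noteq> 0"
    unfolding F_def using ij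
    by (intro lifted_pairing_nonzero[of N "boundary_limit x" "y x" "boundary_limit x'" "y x'" J i j a b] y_rank x) auto
  then show False using x(4) by simp
qed

end

theorem theorem1p2:
  fixes G :: "('a, 'b) monoid_scheme"
    and S :: "'a set"
    and m :: nat
    and \<rho> :: "'a \<Rightarrow> complex mat"
  assumes "m \<ge> 1"
    and "word_hyperbolic G S"
    and "\<rho> \<in> hom G (Sp_group m)"
    and "anosov G S (2 * m) 1 \<rho>"
  shows "\<not> (\<exists>A. A \<subset> topspace (gromov_boundary G S) \<and>
             subtopology (gromov_boundary G S) A homeomorphic_space nsphere 2)"
proof -
  interpret group G using assms(2) by (simp add: word_hyperbolic_def)
  interpret symplectic_rep G S m \<rho>
    using assms by unfold_locales (auto simp: word_hyperbolic_def)
  obtain K where K: "1 \<le> K" "\<And>g. g \<in> carrier G \<Longrightarrow> fro (2 * m) (E g) \<le> fro (2 * m) (E \<one>\<^bsub>G\<^esub>) * K ^ word_length G S g"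
    using ex_growth by blast
  obtain c q where cq: "0 < c" "0 < q" "q < 1"
      "\<And>g. g \<in> carrier G \<Longrightarrow> minor_bound (2 * m) (E g) (c * q ^ word_length G S g)"
    using ex_contraction[OF assms(4)] by blast
  interpret contracting_symplectic_rep G S m \<rho> K c q
    using assms(2) K cq by unfold_locales (auto simp: word_hyperbolic_def)
  show ?thesis using no_proper_sphere by blast
qed

end
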